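(* Let $F$ be a function associating to each set $X$ a structure $F(X)$ in a fixed (possibly many-sorted) first-order signature $\Sigma$, such that: (a) if there is a bijection between $X$ and $Y$, then $F(X)\cong F(Y)$; and (b) $F$ turns disjoint unions of sets into products of structures, i.e. $F\left(\biguplus_{i\in I}X_i\right)\cong\prod_{i\in I}F(X_i)$ for every family of sets $(X_i)_{i\in I}$. Let $K$ be the class of all structures isomorphic to a substructure of $F(X)$ for some set $X$, and let $1=\{*\}$ be the one element set. Then: (1) The class $K$ is closed under substructure and product. (2) Every structure $A\in K$ embeds canonically into a product of copies of $F(1)$ indexed by the set $\mathrm{Hom}_K(A,F(1))$ of homomorphisms from $A$ to $F(1)$: the map $A\to\prod_{\varphi\in\mathrm{Hom}_K(A,F(1))}F(1)\cong F(\mathrm{Hom}_K(A,F(1)))$ whose component at $\varphi$ is $\varphi$ is an embedding. (3) If $K$ is pseudo-elementary, then it is elementary, axiomatized by the Horn clause theory of the structure $F(1)$; that is, $K$ is the class of models of the set of all Horn clauses true in $F(1)$.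
   Context: A class $K$ of $\Sigma$-structures is elementary if there is a first-order $\Sigma$-theory $T$ such that $K$ is the class of models of $T$; it is pseudo-elementary if there are a signature $\Sigma'\supseteq\Sigma$ (possibly with additional sorts) and a first-order $\Sigma'$-theory $T'$ such that $K$ is the class of reducts to $\Sigma$ of models of $T'$. A Horn clause is a formula of the form $(\varphi_1\wedge\dots\wedge\varphi_n)\rightarrow\psi$ with $n\ge 0$ and $\varphi_1,\dots,\varphi_n,\psi$ atomic; it is identified with its universal closure. A Horn clause theory is a set of Horn clauses. *)

theory Defs
  imports Main "HOL-Library.FuncSet" "HOL-Library.Equipollence"
begin

section \<open>Sets and classes\<close>

text \<open>
  The theorem speaks about functions defined on all sets and about proper classes of structures.
  The type \<open>'u\<close> plays the role of the set-theoretic universe: its subsets of cardinality less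
  than \<open>'u\<close> (the small ones) are the sets, up to bijection, and arbitrary predicates on
  \<open>'u\<close>-valued data are the classes. The condition \<open>set_universe\<close> says that the
  cardinality of \<open>'u\<close> is strongly inaccessible, so that the small sets admit the usual
  set-theoretic constructions (this is a Grothendieck universe).
\<close>

definition small :: "'u set \<Rightarrow> bool" where
  "small X \<longleftrightarrow> X \<prec> (UNIV :: 'u set)"

definition set_universe :: "'u itself \<Rightarrow> bool" where
  "set_universe _ \<longleftrightarrow>
     (\<exists>X :: 'u set. infinite X \<and> small X) \<and>
     (\<forall>X :: 'u set. small X \<longrightarrow> Pow X \<prec> (UNIV :: 'u set)) \<and>
     (\<forall>(I :: 'u set) (X :: 'u \<Rightarrow> 'u set).
        small I \<and> (\<forall>i\<in>I. small (X i)) \<longrightarrow> small (\<Union>i\<in>I. X i))"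

text \<open>
  The disjoint union of a family is determined up to bijection; \<open>Z\<close> is any representative
  of it inside the universe.
\<close>

definition is_disjoint_union :: "'u set \<Rightarrow> 'u set \<Rightarrow> ('u \<Rightarrow> 'u set) \<Rightarrow> bool" where
  "is_disjoint_union Z I X \<longleftrightarrow> Z \<approx> (SIGMA i:I. X i)"


section \<open>Many-sorted signatures and structures\<close>

record 'u signature =
  sorts :: "'u set"
  funs :: "'u set"
  rels :: "'u set"
  fun_dom :: "'u \<Rightarrow> 'u list"
  fun_cod :: "'u \<Rightarrow> 'u"
  rel_dom :: "'u \<Rightarrow> 'u list"

definition is_signature :: "'u signature \<Rightarrow> bool" where
  "is_signature \<Sigma> \<longleftrightarrow>
     small (sorts \<Sigma>) \<and> small (funs \<Sigma>) \<and> small (rels \<Sigma>) \<and>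
     (\<forall>f\<in>funs \<Sigma>. set (fun_dom \<Sigma> f) \<subseteq> sorts \<Sigma> \<and> fun_cod \<Sigma> f \<in> sorts \<Sigma>) \<and>
     (\<forall>r\<in>rels \<Sigma>. set (rel_dom \<Sigma> r) \<subseteq> sorts \<Sigma>)"

definition subsignature :: "'u signature \<Rightarrow> 'u signature \<Rightarrow> bool" where
  "subsignature \<Sigma> \<Sigma>' \<longleftrightarrow>
     sorts \<Sigma> \<subseteq> sorts \<Sigma>' \<and> funs \<Sigma> \<subseteq> funs \<Sigma>' \<and> rels \<Sigma> \<subseteq> rels \<Sigma>' \<and>
     (\<forall>f\<in>funs \<Sigma>. fun_dom \<Sigma>' f = fun_dom \<Sigma> f \<and> fun_cod \<Sigma>' f = fun_cod \<Sigma> f) \<and>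
     (\<forall>r\<in>rels \<Sigma>. rel_dom \<Sigma>' r = rel_dom \<Sigma> r)"

text \<open>
  Carriers may be empty. Interpretations are total functions on lists, but only their values
  on well-sorted tuples of symbols of the signature are ever significant.
\<close>

record ('u, 'a) struct =
  carr :: "'u \<Rightarrow> 'a set"
  fint :: "'u \<Rightarrow> 'a list \<Rightarrow> 'a"
  rint :: "'u \<Rightarrow> 'a list \<Rightarrow> bool"

definition tuples :: "('u, 'a) struct \<Rightarrow> 'u list \<Rightarrow> 'a list set" where
  "tuples A ss = {xs. list_all2 (\<lambda>x s. x \<in> carr A s) xs ss}"

definition is_struct :: "'u signature \<Rightarrow> ('u, 'a) struct \<Rightarrow> bool" where
  "is_struct \<Sigma> A \<longleftrightarrow>
     (\<forall>f\<in>funs \<Sigma>. \<forall>xs\<in>tuples A (fun_dom \<Sigma> f). fint A f xs \<in> carr A (fun_cod \<Sigma> f))"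

definition Str :: "'u signature \<Rightarrow> ('u, 'u) struct set" where
  "Str \<Sigma> = {A. is_struct \<Sigma> A \<and> (\<forall>s\<in>sorts \<Sigma>. small (carr A s))}"

text \<open>
  The family of maps constituting a homomorphism is normalised to be \<open>undefined\<close> outside its
  domain, so that \<open>Hom \<Sigma> A B\<close> is in bijection with the actual set of homomorphisms.
\<close>

definition Hom :: "'u signature \<Rightarrow> ('u, 'a) struct \<Rightarrow> ('u, 'b) struct \<Rightarrow> ('u \<Rightarrow> 'a \<Rightarrow> 'b) set" where
  "Hom \<Sigma> A B = {h \<in> (\<Pi>\<^sub>E s\<in>sorts \<Sigma>. carr A s \<rightarrow>\<^sub>E carr B s).
     (\<forall>f\<in>funs \<Sigma>. \<forall>xs\<in>tuples A (fun_dom \<Sigma> f).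
        h (fun_cod \<Sigma> f) (fint A f xs) = fint B f (map2 h (fun_dom \<Sigma> f) xs)) \<and>
     (\<forall>r\<in>rels \<Sigma>. \<forall>xs\<in>tuples A (rel_dom \<Sigma> r).
        rint A r xs \<longrightarrow> rint B r (map2 h (rel_dom \<Sigma> r) xs))}"

definition embedding ::
  "'u signature \<Rightarrow> ('u, 'a) struct \<Rightarrow> ('u, 'b) struct \<Rightarrow> ('u \<Rightarrow> 'a \<Rightarrow> 'b) \<Rightarrow> bool" where
  "embedding \<Sigma> A B h \<longleftrightarrow> h \<in> Hom \<Sigma> A B \<and>
     (\<forall>s\<in>sorts \<Sigma>. inj_on (h s) (carr A s)) \<and>
     (\<forall>r\<in>rels \<Sigma>. \<forall>xs\<in>tuples A (rel_dom \<Sigma> r).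
        rint B r (map2 h (rel_dom \<Sigma> r) xs) \<longrightarrow> rint A r xs)"

definition isomorphic :: "'u signature \<Rightarrow> ('u, 'a) struct \<Rightarrow> ('u, 'b) struct \<Rightarrow> bool" where
  "isomorphic \<Sigma> A B \<longleftrightarrow>
     (\<exists>h. embedding \<Sigma> A B h \<and> (\<forall>s\<in>sorts \<Sigma>. h s ` carr A s = carr B s))"

text \<open>\<open>A\<close> and \<open>B\<close> are the same \<open>\<Sigma>\<close>-structure, ignoring insignificant values.\<close>

definition agree_on :: "'u signature \<Rightarrow> ('u, 'a) struct \<Rightarrow> ('u, 'a) struct \<Rightarrow> bool" where
  "agree_on \<Sigma> A B \<longleftrightarrow>
     (\<forall>s\<in>sorts \<Sigma>. carr A s = carr B s) \<and>
     (\<forall>f\<in>funs \<Sigma>. \<forall>xs\<in>tuples A (fun_dom \<Sigma> f). fint A f xs = fint B f xs) \<and>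
     (\<forall>r\<in>rels \<Sigma>. \<forall>xs\<in>tuples A (rel_dom \<Sigma> r). rint A r xs \<longleftrightarrow> rint B r xs)"

definition substructure :: "'u signature \<Rightarrow> ('u, 'a) struct \<Rightarrow> ('u, 'a) struct \<Rightarrow> bool" where
  "substructure \<Sigma> B A \<longleftrightarrow> is_struct \<Sigma> B \<and> is_struct \<Sigma> A \<and>
     (\<forall>s\<in>sorts \<Sigma>. carr B s \<subseteq> carr A s) \<and>
     (\<forall>f\<in>funs \<Sigma>. \<forall>xs\<in>tuples B (fun_dom \<Sigma> f). fint B f xs = fint A f xs) \<and>
     (\<forall>r\<in>rels \<Sigma>. \<forall>xs\<in>tuples B (rel_dom \<Sigma> r). rint B r xs \<longleftrightarrow> rint A r xs)"

definition prod_struct :: "'i set \<Rightarrow> ('i \<Rightarrow> ('u, 'a) struct) \<Rightarrow> ('u, 'i \<Rightarrow> 'a) struct" where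
  "prod_struct I A = \<lparr>
     carr = (\<lambda>s. \<Pi>\<^sub>E i\<in>I. carr (A i) s),
     fint = (\<lambda>f xs. \<lambda>i\<in>I. fint (A i) f (map (\<lambda>x. x i) xs)),
     rint = (\<lambda>r xs. \<forall>i\<in>I. rint (A i) r (map (\<lambda>x. x i) xs)) \<rparr>"


section \<open>Many-sorted first-order logic with equality\<close>

text \<open>A variable is a pair of a name and its sort.\<close>

datatype 'u trm = Var "nat \<times> 'u" | App 'u "'u trm list"

datatype 'u fm =
    Eq "'u trm" "'u trm"
  | Rel 'u "'u trm list"
  | Falsum
  | Conj "'u fm" "'u fm"
  | Imp "'u fm" "'u fm"
  | All "nat \<times> 'u" "'u fm"

fun sort_of :: "'u signature \<Rightarrow> 'u trm \<Rightarrow> 'u" where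
  "sort_of \<Sigma> (Var x) = snd x"
| "sort_of \<Sigma> (App f ts) = fun_cod \<Sigma> f"

fun is_trm :: "'u signature \<Rightarrow> 'u trm \<Rightarrow> bool" where
  "is_trm \<Sigma> (Var x) \<longleftrightarrow> snd x \<in> sorts \<Sigma>"
| "is_trm \<Sigma> (App f ts) \<longleftrightarrow>
     f \<in> funs \<Sigma> \<and> (\<forall>t\<in>set ts. is_trm \<Sigma> t) \<and> map (sort_of \<Sigma>) ts = fun_dom \<Sigma> f"

fun is_fm :: "'u signature \<Rightarrow> 'u fm \<Rightarrow> bool" where
  "is_fm \<Sigma> (Eq t u) \<longleftrightarrow> is_trm \<Sigma> t \<and> is_trm \<Sigma> u \<and> sort_of \<Sigma> t = sort_of \<Sigma> u"
| "is_fm \<Sigma> (Rel r ts) \<longleftrightarrow>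
     r \<in> rels \<Sigma> \<and> (\<forall>t\<in>set ts. is_trm \<Sigma> t) \<and> map (sort_of \<Sigma>) ts = rel_dom \<Sigma> r"
| "is_fm \<Sigma> Falsum \<longleftrightarrow> True"
| "is_fm \<Sigma> (Conj \<phi> \<psi>) \<longleftrightarrow> is_fm \<Sigma> \<phi> \<and> is_fm \<Sigma> \<psi>"
| "is_fm \<Sigma> (Imp \<phi> \<psi>) \<longleftrightarrow> is_fm \<Sigma> \<phi> \<and> is_fm \<Sigma> \<psi>"
| "is_fm \<Sigma> (All x \<phi>) \<longleftrightarrow> snd x \<in> sorts \<Sigma> \<and> is_fm \<Sigma> \<phi>"

fun trm_vars :: "'u trm \<Rightarrow> (nat \<times> 'u) set" where
  "trm_vars (Var x) = {x}"
| "trm_vars (App f ts) = (\<Union>t\<in>set ts. trm_vars t)"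

fun free_vars :: "'u fm \<Rightarrow> (nat \<times> 'u) set" where
  "free_vars (Eq t u) = trm_vars t \<union> trm_vars u"
| "free_vars (Rel r ts) = (\<Union>t\<in>set ts. trm_vars t)"
| "free_vars Falsum = {}"
| "free_vars (Conj \<phi> \<psi>) = free_vars \<phi> \<union> free_vars \<psi>"
| "free_vars (Imp \<phi> \<psi>) = free_vars \<phi> \<union> free_vars \<psi>"
| "free_vars (All x \<phi>) = free_vars \<phi> - {x}"

definition sentences :: "'u signature \<Rightarrow> 'u fm set" where
  "sentences \<Sigma> = {\<phi>. is_fm \<Sigma> \<phi> \<and> free_vars \<phi> = {}}"

fun val :: "('u, 'a) struct \<Rightarrow> (nat \<times> 'u \<Rightarrow> 'a) \<Rightarrow> 'u trm \<Rightarrow> 'a" where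
  "val A e (Var x) = e x"
| "val A e (App f ts) = fint A f (map (val A e) ts)"

fun sat :: "('u, 'a) struct \<Rightarrow> (nat \<times> 'u \<Rightarrow> 'a) \<Rightarrow> 'u fm \<Rightarrow> bool" where
  "sat A e (Eq t u) \<longleftrightarrow> val A e t = val A e u"
| "sat A e (Rel r ts) \<longleftrightarrow> rint A r (map (val A e) ts)"
| "sat A e Falsum \<longleftrightarrow> False"
| "sat A e (Conj \<phi> \<psi>) \<longleftrightarrow> sat A e \<phi> \<and> sat A e \<psi>"
| "sat A e (Imp \<phi> \<psi>) \<longleftrightarrow> (sat A e \<phi> \<longrightarrow> sat A e \<psi>)"
| "sat A e (All x \<phi>) \<longleftrightarrow> (\<forall>a\<in>carr A (snd x). sat A (e(x := a)) \<phi>)"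

text \<open>
  Truth of a sentence. The valuation is irrelevant for sentences; it deliberately need not take
  values in the carriers, so that nothing becomes vacuously true when some carrier is empty.
\<close>

definition holds :: "('u, 'a) struct \<Rightarrow> 'u fm \<Rightarrow> bool" where
  "holds A \<phi> \<longleftrightarrow> (\<forall>e. sat A e \<phi>)"

definition Mod :: "'u signature \<Rightarrow> 'u fm set \<Rightarrow> ('u, 'u) struct set" where
  "Mod \<Sigma> T = {A \<in> Str \<Sigma>. \<forall>\<phi>\<in>T. holds A \<phi>}"

definition elementary :: "'u signature \<Rightarrow> ('u, 'u) struct set \<Rightarrow> bool" where
  "elementary \<Sigma> K \<longleftrightarrow> (\<exists>T \<subseteq> sentences \<Sigma>. K = Mod \<Sigma> T)"

text \<open>
  A \<open>\<Sigma>'\<close>-structure can be used directly as a \<open>\<Sigma>\<close>-structure, hence \<open>A\<close> is the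
  \<open>\<Sigma>\<close>-reduct of \<open>M\<close> iff they agree on \<open>\<Sigma>\<close>.
\<close>

definition pseudo_elementary :: "'u signature \<Rightarrow> ('u, 'u) struct set \<Rightarrow> bool" where
  "pseudo_elementary \<Sigma> K \<longleftrightarrow>
     (\<exists>\<Sigma>' T'. is_signature \<Sigma>' \<and> subsignature \<Sigma> \<Sigma>' \<and> T' \<subseteq> sentences \<Sigma>' \<and>
        K = {A \<in> Str \<Sigma>. \<exists>M\<in>Mod \<Sigma>' T'. agree_on \<Sigma> A M})"

definition atomic :: "'u fm \<Rightarrow> bool" where
  "atomic \<phi> \<longleftrightarrow> (\<exists>t u. \<phi> = Eq t u) \<or> (\<exists>r ts. \<phi> = Rel r ts)"

definition BigConj :: "'u fm list \<Rightarrow> 'u fm" where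
  "BigConj \<phi>s = foldr Conj \<phi>s (Imp Falsum Falsum)"

text \<open>Universally closed Horn clauses, with the free variables quantified in any order.\<close>

definition horn_clauses :: "'u signature \<Rightarrow> 'u fm set" where
  "horn_clauses \<Sigma> = {foldr All xs (Imp (BigConj \<phi>s) \<psi>) | xs \<phi>s \<psi>.
     (\<forall>\<phi>\<in>set \<phi>s. atomic \<phi> \<and> is_fm \<Sigma> \<phi>) \<and> atomic \<psi> \<and> is_fm \<Sigma> \<psi> \<and>
     distinct xs \<and> set xs = free_vars (Imp (BigConj \<phi>s) \<psi>)}"

definition horn_theory :: "'u signature \<Rightarrow> ('u, 'a) struct \<Rightarrow> 'u fm set" where
  "horn_theory \<Sigma> A = {\<phi> \<in> horn_clauses \<Sigma>. holds A \<phi>}"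


section \<open>The class generated by F\<close>

text \<open>
  The class is defined for structures with elements in an arbitrary type, so that it can be
  asked directly whether a product structure, whose elements are functions, belongs to it. Its
  instance at \<open>'a = 'u\<close> is the class of structures in the universe. It is closed under
  isomorphism, also between structures over different types.
\<close>

definition gen_class ::
  "'u signature \<Rightarrow> ('u set \<Rightarrow> ('u, 'u) struct) \<Rightarrow> ('u, 'a) struct set" where
  "gen_class \<Sigma> F = {A. is_struct \<Sigma> A \<and>
     (\<exists>X B. small X \<and> substructure \<Sigma> B (F X) \<and> isomorphic \<Sigma> A B)}"

end

theory Submission
  imports Defs
begin

text \<open>
  A structure \<open>A\<close> is separated by its homomorphisms to \<open>F {pt}\<close> if they tell apart any two distinct
  elements and send any tuple outside a relation to some tuple outside it. Everything rests on the
  lemma \<open>gen_class_iff_separated\<close>: the members of \<open>K\<close> are the separated structures with small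
  carriers. Since a set is the disjoint union of its singletons, \<open>F X\<close> is isomorphic to the power of
  \<open>F {pt}\<close> with exponent \<open>X\<close>. Powers of \<open>F {pt}\<close> and their substructures are separated, by
  the projections. Conversely, separation says that evaluation embeds \<open>A\<close> into the power indexed
  by its homomorphisms, and that power is \<open>F Z\<close> for an equipotent set \<open>Z\<close>; such a \<open>Z\<close> exists
  by inaccessibility of the universe. Closure under substructures and products and the canonical
  embedding follow from this by restricting homomorphisms and composing them with projections.

  A separated structure satisfies the Horn clauses of \<open>F {pt}\<close>: a homomorphism under which the
  conclusion still fails transports a counterexample. The converse, for a pseudo-elementary \<open>K\<close>,
  is the point where a compactness argument is needed. Let \<open>A\<close> be a model of the Horn theory and
  consider an atom that fails in \<open>A\<close>. Finitely many true atoms together with the failing one form a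
  Horn clause refuted by \<open>A\<close>, hence by \<open>F {pt}\<close>. So every finite piece of \<open>A\<close> has a map to
  \<open>F {pt}\<close> that respects the true atoms in the piece and under which the chosen atom still fails
  (\<open>horn_theory_local_hom\<close>). In an ultrapower over the finite pieces, these maps glue to a
  homomorphism under which the atom fails. The ultrapower is taken of a model of the theory over the
  larger signature whose reduct is \<open>F {pt}\<close>. By the theorem of Los (\<open>sat_power\<close>) it is again a
  model, and it is small because a power of a small set by a small set is. So its reduct belongs to
  \<open>K\<close>, and composition with homomorphisms separating this reduct finishes the proof
  (\<open>horn_model_separated\<close>).
\<close>

section \<open>Sets of size below the universe\<close>

lemma lesspoll_UNIV_code:
  assumes "X \<prec> (UNIV :: 'u set)"
  obtains c :: "'a \<Rightarrow> 'u" where "inj_on c X" "small (c ` X)"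
proof -
  obtain c :: "'a \<Rightarrow> 'u" where c: "inj_on c X"
    using lesspoll_imp_lepoll[OF assms] unfolding lepoll_def by blast
  moreover have "small (c ` X)"
    unfolding small_def using c assms by simp
  ultimately show ?thesis using that by blast
qed

lemma universe_infinite:
  assumes "set_universe TYPE('u)"
  shows "infinite (UNIV :: 'u set)"
  using assms infinite_super[OF subset_UNIV] unfolding set_universe_def by blast

lemma universe_pairing:
  assumes "set_universe TYPE('u)"
  obtains p :: "'u \<times> 'u \<Rightarrow> 'u" where "inj p"
proof -
  have "(UNIV :: 'u set) \<times> (UNIV :: 'u set) \<approx> (UNIV :: 'u set)"
    using card_of_Times_same_infinite[OF universe_infinite[OF assms]]
    unfolding eqpoll_iff_card_of_ordIso .
  then show ?thesis
    using that unfolding eqpoll_def bij_betw_def by (auto simp: UNIV_Times_UNIV)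
qed

text \<open>
  Regularity of the cardinality of the universe is about unions of sets in the universe; codes
  by a pairing function extend it to families over any types.
\<close>

lemma lesspoll_UNIV_Sigma:
  assumes univ: "set_universe TYPE('u)"
    and I: "I \<prec> (UNIV :: 'u set)" and X: "\<And>i. i \<in> I \<Longrightarrow> X i \<prec> (UNIV :: 'u set)"
  shows "(SIGMA i:I. X i) \<prec> (UNIV :: 'u set)"
proof -
  obtain p :: "'u \<times> 'u \<Rightarrow> 'u" where p: "inj p" using universe_pairing[OF univ] .
  obtain k :: "_ \<Rightarrow> 'u" where k: "inj_on k I" "small (k ` I)"
    using lesspoll_UNIV_code[OF I] .
  have "\<forall>i\<in>I. \<exists>c :: _ \<Rightarrow> 'u. inj_on c (X i) \<and> small (c ` X i)"
    using lesspoll_UNIV_code[OF X] by metis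
  then obtain c :: "_ \<Rightarrow> _ \<Rightarrow> 'u" where c: "\<And>i. i \<in> I \<Longrightarrow> inj_on (c i) (X i)"
      "\<And>i. i \<in> I \<Longrightarrow> small (c i ` X i)" by metis
  let ?e = "\<lambda>(i, x). p (k i, c i x)"
  define Y where "Y j = ?e ` ({inv_into I k j} \<times> X (inv_into I k j))" for j
  have small_Y: "small (Y j)" if j: "j \<in> k ` I" for j
  proof -
    obtain i where i: "i \<in> I" "j = k i" using j by blast
    then have "Y j = (\<lambda>y. p (k i, y)) ` c i ` X i"
      using k by (force simp: Y_def)
    also have "\<dots> \<approx> c i ` X i"
      by (intro inj_on_image_eqpoll_self inj_onI) (simp add: inj_eq[OF p])
    finally show ?thesis using c(2)[OF i(1)] unfolding small_def by (rule eq_lesspoll_trans)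
  qed
  have "?e ` (SIGMA i:I. X i) = (\<Union>j\<in>k ` I. Y j)"
    using k(1) by (force simp: Y_def)
  moreover have "small (\<Union>j\<in>k ` I. Y j)"
    using univ k(2) small_Y unfolding set_universe_def by blast
  moreover have "inj_on ?e (SIGMA i:I. X i)"
    by (rule inj_onI) (clarsimp simp: inj_eq[OF p] inj_on_eq_iff[OF k(1)] inj_on_eq_iff[OF c(1)])
  ultimately show ?thesis unfolding small_def
    by (metis inj_on_image_lesspoll_1)
qed

lemma lesspoll_UNIV_Pow:
  assumes "set_universe TYPE('u)" and "X \<prec> (UNIV :: 'u set)"
  shows "Pow X \<prec> (UNIV :: 'u set)"
proof -
  obtain c :: "_ \<Rightarrow> 'u" where c: "inj_on c X" "small (c ` X)"
    using lesspoll_UNIV_code[OF assms(2)] .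
  have "(`) c ` Pow X \<prec> (UNIV :: 'u set)"
    unfolding image_Pow_surj[OF refl] using assms(1) c(2) unfolding set_universe_def by blast
  then show ?thesis using inj_on_image_Pow[OF c(1)] by simp
qed

lemma lesspoll_UNIV_PiE:
  assumes "set_universe TYPE('u)"
    and "I \<prec> (UNIV :: 'u set)" and "\<And>i. i \<in> I \<Longrightarrow> X i \<prec> (UNIV :: 'u set)"
  shows "(\<Pi>\<^sub>E i\<in>I. X i) \<prec> (UNIV :: 'u set)"
proof -
  let ?graph = "\<lambda>f. (\<lambda>i. (i, f i)) ` I"
  have "inj_on ?graph (\<Pi>\<^sub>E i\<in>I. X i)"
    by (rule inj_onI, rule PiE_ext) (assumption | blast)+
  moreover have "?graph ` (\<Pi>\<^sub>E i\<in>I. X i) \<subseteq> Pow (SIGMA i:I. X i)"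
    by (auto simp: PiE_iff)
  ultimately have "(\<Pi>\<^sub>E i\<in>I. X i) \<lesssim> Pow (SIGMA i:I. X i)"
    unfolding lepoll_def by blast
  also have "\<dots> \<prec> (UNIV :: 'u set)"
    using assms by (intro lesspoll_UNIV_Pow lesspoll_UNIV_Sigma)
  finally show ?thesis .
qed

lemma lesspoll_UNIV_Plus:
  assumes univ: "set_universe TYPE('u)"
    and X: "X \<prec> (UNIV :: 'u set)" and Y: "Y \<prec> (UNIV :: 'u set)"
  shows "X <+> Y \<prec> (UNIV :: 'u set)"
proof -
  let ?S = "SIGMA b:UNIV. if b then Inl ` X else Inr ` Y"
  have "X <+> Y = (\<Union>b. if b then Inl ` X else Inr ` Y)"
    unfolding Plus_def UNIV_bool by (simp add: Un_commute)
  also have "\<dots> = snd ` ?S" by (simp add: snd_image_Sigma)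
  finally have "X <+> Y \<lesssim> ?S" by (simp only: image_lepoll)
  also have "?S \<prec> (UNIV :: 'u set)"
    using X Y universe_infinite[OF univ]
    by (intro lesspoll_UNIV_Sigma univ) (simp_all add: finite_lesspoll_infinite)
  finally show ?thesis .
qed

lemma small_representative:
  assumes "X \<prec> (UNIV :: 'u set)"
  obtains Z :: "'u set" where "small Z" "Z \<approx> X"
  using lesspoll_UNIV_code[OF assms] inj_on_image_eqpoll_self by metis

section \<open>Homomorphisms, embeddings and products\<close>

lemma signature_sorts:
  assumes "is_signature \<Sigma>"
  shows "f \<in> funs \<Sigma> \<Longrightarrow> set (fun_dom \<Sigma> f) \<subseteq> sorts \<Sigma>" "f \<in> funs \<Sigma> \<Longrightarrow> fun_cod \<Sigma> f \<in> sorts \<Sigma>"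
    "r \<in> rels \<Sigma> \<Longrightarrow> set (rel_dom \<Sigma> r) \<subseteq> sorts \<Sigma>"
  using assms unfolding is_signature_def by auto

lemma tuples_map2:
  assumes "xs \<in> tuples A ss" "\<And>s a. s \<in> set ss \<Longrightarrow> a \<in> carr A s \<Longrightarrow> h s a \<in> carr B s"
  shows "map2 h ss xs \<in> tuples B ss"
proof -
  have "list_all2 (\<lambda>x s. x \<in> carr A s) xs ss" using assms(1) by (simp add: tuples_def)
  then have "list_all2 (\<lambda>x s. x \<in> carr B s) (map2 h ss xs) ss"
    using assms(2) by (induction rule: list_all2_induct) auto
  then show ?thesis by (simp add: tuples_def)
qed

lemma map2_tuples_cong:
  assumes "xs \<in> tuples A ss" "\<And>s a. s \<in> set ss \<Longrightarrow> a \<in> carr A s \<Longrightarrow> h s a = g s a"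
  shows "map2 h ss xs = map2 g ss xs"
proof -
  have "list_all2 (\<lambda>x s. x \<in> carr A s) xs ss" using assms(1) by (simp add: tuples_def)
  then show ?thesis
    using assms(2) by (induction rule: list_all2_induct) auto
qed

lemma map2_map2: "map2 g ss (map2 h ss xs) = map2 (\<lambda>s a. g s (h s a)) ss xs"
proof (induction ss arbitrary: xs)
  case (Cons s ss)
  then show ?case by (cases xs) auto
qed simp

lemma map2_tuples_id:
  assumes "xs \<in> tuples A ss" shows "map2 (\<lambda>s a. a) ss xs = xs"
proof -
  have "list_all2 (\<lambda>x s. x \<in> carr A s) xs ss" using assms(1) by (simp add: tuples_def)
  then show ?thesis by (induction rule: list_all2_induct) auto
qed

lemma Hom_carr: "h \<in> Hom \<Sigma> A B \<Longrightarrow> s \<in> sorts \<Sigma> \<Longrightarrow> a \<in> carr A s \<Longrightarrow> h s a \<in> carr B s"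
  unfolding Hom_def by (auto simp: PiE_iff)

lemma Hom_fint:
  "h \<in> Hom \<Sigma> A B \<Longrightarrow> f \<in> funs \<Sigma> \<Longrightarrow> xs \<in> tuples A (fun_dom \<Sigma> f) \<Longrightarrow>
   h (fun_cod \<Sigma> f) (fint A f xs) = fint B f (map2 h (fun_dom \<Sigma> f) xs)"
  unfolding Hom_def by auto

lemma Hom_rint:
  "h \<in> Hom \<Sigma> A B \<Longrightarrow> r \<in> rels \<Sigma> \<Longrightarrow> xs \<in> tuples A (rel_dom \<Sigma> r) \<Longrightarrow>
   rint A r xs \<Longrightarrow> rint B r (map2 h (rel_dom \<Sigma> r) xs)"
  unfolding Hom_def by auto

lemma Hom_tuples:
  "h \<in> Hom \<Sigma> A B \<Longrightarrow> set ss \<subseteq> sorts \<Sigma> \<Longrightarrow> xs \<in> tuples A ss \<Longrightarrow> map2 h ss xs \<in> tuples B ss"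
  by (rule tuples_map2) (auto intro: Hom_carr)

text \<open>
  The elements of \<open>Hom\<close> are undefined outside the carriers, which \<open>hom_family\<close> enforces for a
  family of maps given by a formula.
\<close>

definition hom_family :: "'u signature \<Rightarrow> ('u, 'a) struct \<Rightarrow> ('u \<Rightarrow> 'a \<Rightarrow> 'b) \<Rightarrow> 'u \<Rightarrow> 'a \<Rightarrow> 'b" where
  "hom_family \<Sigma> A h = (\<lambda>s\<in>sorts \<Sigma>. \<lambda>a\<in>carr A s. h s a)"

lemma hom_family_apply [simp]:
  "s \<in> sorts \<Sigma> \<Longrightarrow> a \<in> carr A s \<Longrightarrow> hom_family \<Sigma> A h s a = h s a"
  by (simp add: hom_family_def)

lemma map2_hom_family:
  assumes "set ss \<subseteq> sorts \<Sigma>" "xs \<in> tuples A ss"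
  shows "map2 (hom_family \<Sigma> A h) ss xs = map2 h ss xs"
  by (rule map2_tuples_cong[OF assms(2)]) (use assms(1) in auto)

lemma hom_family_in_Hom:
  assumes sig: "is_signature \<Sigma>" and A: "is_struct \<Sigma> A"
    and "\<And>s a. s \<in> sorts \<Sigma> \<Longrightarrow> a \<in> carr A s \<Longrightarrow> h s a \<in> carr B s"
    and "\<And>f xs. f \<in> funs \<Sigma> \<Longrightarrow> xs \<in> tuples A (fun_dom \<Sigma> f) \<Longrightarrow>
      h (fun_cod \<Sigma> f) (fint A f xs) = fint B f (map2 h (fun_dom \<Sigma> f) xs)"
    and "\<And>r xs. r \<in> rels \<Sigma> \<Longrightarrow> xs \<in> tuples A (rel_dom \<Sigma> r) \<Longrightarrow> rint A r xs \<Longrightarrow>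
      rint B r (map2 h (rel_dom \<Sigma> r) xs)"
  shows "hom_family \<Sigma> A h \<in> Hom \<Sigma> A B"
proof -
  have "hom_family \<Sigma> A h \<in> (\<Pi>\<^sub>E s\<in>sorts \<Sigma>. carr A s \<rightarrow>\<^sub>E carr B s)"
    using assms(3) by (auto simp: hom_family_def PiE_iff)
  moreover have "fint A f xs \<in> carr A (fun_cod \<Sigma> f)" if "f \<in> funs \<Sigma>" "xs \<in> tuples A (fun_dom \<Sigma> f)" for f xs
    using A that unfolding is_struct_def by blast
  ultimately show ?thesis
    using assms(4,5) signature_sorts[OF sig]
    by (simp add: Hom_def map2_hom_family)
qed

lemma Hom_compose:
  assumes sig: "is_signature \<Sigma>" and A: "is_struct \<Sigma> A"
    and h: "h \<in> Hom \<Sigma> A B" and g: "g \<in> Hom \<Sigma> B C"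
  shows "hom_family \<Sigma> A (\<lambda>s a. g s (h s a)) \<in> Hom \<Sigma> A C"
  using assms signature_sorts[OF sig]
  by (intro hom_family_in_Hom)
    (auto intro!: Hom_carr[OF g] Hom_carr[OF h] simp: Hom_fint[OF h] Hom_fint[OF g] Hom_tuples[OF h]
       map2_map2[symmetric] Hom_rint[OF h] Hom_rint[OF g] simp del: map2_map2)

lemma Hom_id:
  assumes "is_signature \<Sigma>" "is_struct \<Sigma> A"
  shows "hom_family \<Sigma> A (\<lambda>s a. a) \<in> Hom \<Sigma> A A"
  using assms by (intro hom_family_in_Hom) (auto simp: map2_tuples_id)

lemma Hom_prod_proj:
  assumes sig: "is_signature \<Sigma>" and P: "is_struct \<Sigma> (prod_struct I A)" and "i \<in> I"
  shows "hom_family \<Sigma> (prod_struct I A) (\<lambda>s x. x i) \<in> Hom \<Sigma> (prod_struct I A) (A i)"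
proof (rule hom_family_in_Hom[OF sig P])
  have "map2 (\<lambda>s x. x i) ss xs = map (\<lambda>x. x i) xs" if "xs \<in> tuples (prod_struct I A) ss" for ss xs
    using that by (auto simp: tuples_def list_all2_lengthD intro!: nth_equalityI)
  then show "(\<lambda>s x. x i) (fun_cod \<Sigma> f) (fint (prod_struct I A) f xs)
      = fint (A i) f (map2 (\<lambda>s x. x i) (fun_dom \<Sigma> f) xs)"
    if "f \<in> funs \<Sigma>" "xs \<in> tuples (prod_struct I A) (fun_dom \<Sigma> f)" for f xs
    using that \<open>i \<in> I\<close> by (simp add: prod_struct_def)
  show "rint (A i) r (map2 (\<lambda>s x. x i) (rel_dom \<Sigma> r) xs)"
    if "r \<in> rels \<Sigma>" "xs \<in> tuples (prod_struct I A) (rel_dom \<Sigma> r)" "rint (prod_struct I A) r xs" for r xs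
    using that \<open>i \<in> I\<close> \<open>\<And>ss xs. xs \<in> tuples (prod_struct I A) ss \<Longrightarrow> map2 (\<lambda>s x. x i) ss xs = map (\<lambda>x. x i) xs\<close>
    by (simp add: prod_struct_def)
qed (use \<open>i \<in> I\<close> in \<open>auto simp: prod_struct_def\<close>)

lemma is_struct_prod:
  assumes A: "\<And>i. i \<in> I \<Longrightarrow> is_struct \<Sigma> (A i)"
  shows "is_struct \<Sigma> (prod_struct I A)"
proof -
  have "map (\<lambda>x. x i) xs \<in> tuples (A i) ss" if "xs \<in> tuples (prod_struct I A) ss" "i \<in> I" for xs ss i
    using that by (force simp: tuples_def list_all2_conv_all_nth prod_struct_def)
  then show ?thesis
    using A by (auto simp: is_struct_def prod_struct_def)
qed

lemma embedding_compose:
  assumes sig: "is_signature \<Sigma>" and A: "is_struct \<Sigma> A"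
    and h: "embedding \<Sigma> A B h" and g: "embedding \<Sigma> B C g"
  shows "embedding \<Sigma> A C (hom_family \<Sigma> A (\<lambda>s a. g s (h s a)))"
proof -
  have H: "h \<in> Hom \<Sigma> A B" "g \<in> Hom \<Sigma> B C" using h g by (auto simp: embedding_def)
  have "inj_on (hom_family \<Sigma> A (\<lambda>s a. g s (h s a)) s) (carr A s)" if s: "s \<in> sorts \<Sigma>" for s
    using h g s Hom_carr[OF H(1) s] by (auto simp: embedding_def inj_on_def)
  moreover have "rint A r xs"
    if r: "r \<in> rels \<Sigma>" and xs: "xs \<in> tuples A (rel_dom \<Sigma> r)"
      and "rint C r (map2 (hom_family \<Sigma> A (\<lambda>s a. g s (h s a))) (rel_dom \<Sigma> r) xs)" for r xs
  proof -
    have "rint C r (map2 g (rel_dom \<Sigma> r) (map2 h (rel_dom \<Sigma> r) xs))"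
      using that signature_sorts(3)[OF sig r] by (simp add: map2_hom_family map2_map2)
    then show ?thesis
      using h g r xs Hom_tuples[OF H(1) signature_sorts(3)[OF sig r] xs] by (auto simp: embedding_def)
  qed
  ultimately show ?thesis
    using Hom_compose[OF sig A H] unfolding embedding_def by blast
qed

lemma isomorphic_trans:
  assumes sig: "is_signature \<Sigma>" and A: "is_struct \<Sigma> A"
    and "isomorphic \<Sigma> A B" "isomorphic \<Sigma> B C"
  shows "isomorphic \<Sigma> A C"
proof -
  obtain h g where h: "embedding \<Sigma> A B h" "\<And>s. s \<in> sorts \<Sigma> \<Longrightarrow> h s ` carr A s = carr B s"
    and g: "embedding \<Sigma> B C g" "\<And>s. s \<in> sorts \<Sigma> \<Longrightarrow> g s ` carr B s = carr C s"
    using assms unfolding isomorphic_def by metis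
  have "hom_family \<Sigma> A (\<lambda>s a. g s (h s a)) s ` carr A s = carr C s" if s: "s \<in> sorts \<Sigma>" for s
    using s unfolding g(2)[OF s, symmetric] h(2)[OF s, symmetric] image_image by simp
  then show ?thesis
    using embedding_compose[OF sig A h(1) g(1)] unfolding isomorphic_def by blast
qed

lemma isomorphic_sym:
  assumes sig: "is_signature \<Sigma>" and A: "is_struct \<Sigma> A" and B: "is_struct \<Sigma> B"
    and "isomorphic \<Sigma> A B"
  shows "isomorphic \<Sigma> B A"
proof -
  obtain h where h: "embedding \<Sigma> A B h" and im: "\<And>s. s \<in> sorts \<Sigma> \<Longrightarrow> h s ` carr A s = carr B s"
    using assms(4) unfolding isomorphic_def by metis
  have H: "h \<in> Hom \<Sigma> A B" and inj: "\<And>s. s \<in> sorts \<Sigma> \<Longrightarrow> inj_on (h s) (carr A s)"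
    using h by (auto simp: embedding_def)
  define g where "g s = inv_into (carr A s) (h s)" for s
  have gh: "g s (h s a) = a" if "s \<in> sorts \<Sigma>" "a \<in> carr A s" for s a
    using inj that by (simp add: g_def)
  have hg: "h s (g s b) = b" "g s b \<in> carr A s" if "s \<in> sorts \<Sigma>" "b \<in> carr B s" for s b
    using im that by (auto simp: g_def f_inv_into_f inv_into_into)
  have tup: "map2 g ss ys \<in> tuples A ss" if "set ss \<subseteq> sorts \<Sigma>" "ys \<in> tuples B ss" for ss ys
    using that hg by (intro tuples_map2[OF that(2)]) auto
  have hgs: "map2 h ss (map2 g ss ys) = ys" if "set ss \<subseteq> sorts \<Sigma>" "ys \<in> tuples B ss" for ss ys
  proof -
    have "map2 h ss (map2 g ss ys) = map2 (\<lambda>s a. a) ss ys"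
      unfolding map2_map2 using that hg by (intro map2_tuples_cong[OF that(2)]) auto
    then show ?thesis using map2_tuples_id[OF that(2)] by simp
  qed
  have rint: "rint A r (map2 g (rel_dom \<Sigma> r) ys) \<longleftrightarrow> rint B r ys"
    if r: "r \<in> rels \<Sigma>" and ys: "ys \<in> tuples B (rel_dom \<Sigma> r)" for r ys
    using h r tup[OF signature_sorts(3)[OF sig r] ys] hgs[OF signature_sorts(3)[OF sig r] ys]
      Hom_rint[OF H r] unfolding embedding_def by metis
  have "hom_family \<Sigma> B g \<in> Hom \<Sigma> B A"
  proof (rule hom_family_in_Hom[OF sig B])
    fix f ys assume f: "f \<in> funs \<Sigma>" and ys: "ys \<in> tuples B (fun_dom \<Sigma> f)"
    note xs = tup[OF signature_sorts(1)[OF sig f] ys]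
    have "fint A f (map2 g (fun_dom \<Sigma> f) ys) \<in> carr A (fun_cod \<Sigma> f)"
      using A f xs unfolding is_struct_def by blast
    then have "g (fun_cod \<Sigma> f) (h (fun_cod \<Sigma> f) (fint A f (map2 g (fun_dom \<Sigma> f) ys)))
        = fint A f (map2 g (fun_dom \<Sigma> f) ys)"
      using gh signature_sorts(2)[OF sig f] by blast
    then show "g (fun_cod \<Sigma> f) (fint B f ys) = fint A f (map2 g (fun_dom \<Sigma> f) ys)"
      unfolding Hom_fint[OF H f xs] hgs[OF signature_sorts(1)[OF sig f] ys] .
  qed (use hg rint in auto)
  moreover have "inj_on (hom_family \<Sigma> B g s) (carr B s)" if "s \<in> sorts \<Sigma>" for s
    using hg(1)[OF that] that by (intro inj_on_inverseI[of _ "h s"]) simp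
  moreover have "hom_family \<Sigma> B g s ` carr B s = carr A s" if s: "s \<in> sorts \<Sigma>" for s
  proof -
    have "hom_family \<Sigma> B g s ` carr B s = g s ` h s ` carr A s"
      unfolding im[OF s] using s by simp
    then show ?thesis using gh[OF s] by (simp add: image_image)
  qed
  ultimately show ?thesis
    unfolding isomorphic_def embedding_def
    using rint by (metis map2_hom_family signature_sorts(3)[OF sig])
qed

text \<open>
  Two changes of a product occur below at the same time: the structures assigned to the singletons
  of a set are isomorphic but may differ, and the power to be recognised has homomorphisms, which are
  not elements of the universe, as indices.
\<close>

lemma isomorphic_prod_reindex:
  assumes sig: "is_signature \<Sigma>" and P: "is_struct \<Sigma> (prod_struct I A)"
    and b: "bij_betw b J I" and iso: "\<And>j. j \<in> J \<Longrightarrow> isomorphic \<Sigma> (A (b j)) (B j)"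
  shows "isomorphic \<Sigma> (prod_struct I A) (prod_struct J B)"
proof -
  have "\<forall>j\<in>J. \<exists>k. embedding \<Sigma> (A (b j)) (B j) k \<and> (\<forall>s\<in>sorts \<Sigma>. k s ` carr (A (b j)) s = carr (B j) s)"
    using iso unfolding isomorphic_def by blast
  then obtain k where k: "\<And>j. j \<in> J \<Longrightarrow> embedding \<Sigma> (A (b j)) (B j) (k j)"
    and im: "\<And>j s. j \<in> J \<Longrightarrow> s \<in> sorts \<Sigma> \<Longrightarrow> k j s ` carr (A (b j)) s = carr (B j) s"
    by metis
  have K: "k j \<in> Hom \<Sigma> (A (b j)) (B j)" if "j \<in> J" for j using k[OF that] by (simp add: embedding_def)
  have bI: "b j \<in> I" if "j \<in> J" for j using b that by (auto simp: bij_betw_def)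
  have Ib: "i \<in> b ` J" if "i \<in> I" for i using b that by (auto simp: bij_betw_def)
  define h where "h s x = (\<lambda>j\<in>J. k j s (x (b j)))" for s x
  have proj: "map (\<lambda>x. x i) xs \<in> tuples (A i) ss" if "xs \<in> tuples (prod_struct I A) ss" "i \<in> I" for xs ss i
    using that by (force simp: tuples_def list_all2_conv_all_nth prod_struct_def)
  have comp: "map (\<lambda>x. x j) (map2 h ss xs) = map2 (k j) ss (map (\<lambda>x. x (b j)) xs)" if "j \<in> J" for j ss xs
    using that by (auto simp: h_def zip_map2)
  have rint: "rint (prod_struct J B) r (map2 h (rel_dom \<Sigma> r) xs) \<longleftrightarrow> rint (prod_struct I A) r xs"
    if r: "r \<in> rels \<Sigma>" and xs: "xs \<in> tuples (prod_struct I A) (rel_dom \<Sigma> r)" for r xs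
  proof -
    have "rint (prod_struct J B) r (map2 h (rel_dom \<Sigma> r) xs)
        \<longleftrightarrow> (\<forall>j\<in>J. rint (B j) r (map2 (k j) (rel_dom \<Sigma> r) (map (\<lambda>x. x (b j)) xs)))"
      by (simp add: prod_struct_def comp del: map_map)
    also have "\<dots> \<longleftrightarrow> (\<forall>j\<in>J. rint (A (b j)) r (map (\<lambda>x. x (b j)) xs))"
      using k proj[OF xs bI] Hom_rint[OF K r] r unfolding embedding_def by blast
    also have "\<dots> \<longleftrightarrow> (\<forall>i\<in>I. rint (A i) r (map (\<lambda>x. x i) xs))"
      using b unfolding bij_betw_def by blast
    finally show ?thesis by (simp add: prod_struct_def)
  qed
  have hom: "hom_family \<Sigma> (prod_struct I A) h \<in> Hom \<Sigma> (prod_struct I A) (prod_struct J B)"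
  proof (rule hom_family_in_Hom[OF sig P])
    show "h s x \<in> carr (prod_struct J B) s" if "s \<in> sorts \<Sigma>" "x \<in> carr (prod_struct I A) s" for s x
      using that bI by (auto simp: h_def prod_struct_def PiE_iff intro!: Hom_carr[OF K])
    show "h (fun_cod \<Sigma> f) (fint (prod_struct I A) f xs) = fint (prod_struct J B) f (map2 h (fun_dom \<Sigma> f) xs)"
      if f: "f \<in> funs \<Sigma>" and xs: "xs \<in> tuples (prod_struct I A) (fun_dom \<Sigma> f)" for f xs
      using Hom_fint[OF K f proj[OF xs bI]] bI
      by (auto simp: prod_struct_def comp h_def[of "fun_cod \<Sigma> f"] simp del: map_map intro!: restrict_ext)
  qed (use rint in auto)
  moreover have "inj_on (hom_family \<Sigma> (prod_struct I A) h s) (carr (prod_struct I A) s)" if s: "s \<in> sorts \<Sigma>" for s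
  proof (rule inj_onI)
    fix x y assume x: "x \<in> carr (prod_struct I A) s" and y: "y \<in> carr (prod_struct I A) s"
      and "hom_family \<Sigma> (prod_struct I A) h s x = hom_family \<Sigma> (prod_struct I A) h s y"
    then have eq: "k j s (x (b j)) = k j s (y (b j))" if "j \<in> J" for j
      using s that by (auto simp: h_def dest: fun_cong[of _ _ j])
    have "x i = y i" if "i \<in> I" for i
    proof -
      obtain j where j: "j \<in> J" "i = b j" using Ib[OF \<open>i \<in> I\<close>] by blast
      moreover have "inj_on (k j s) (carr (A i) s)" using k[OF j(1)] s j by (simp add: embedding_def)
      ultimately show ?thesis
        using eq[OF j(1)] x y that by (auto simp: prod_struct_def PiE_iff dest: inj_onD)
    qed
    then show "x = y" using x y by (intro PiE_ext[of x I _ y]) (auto simp: prod_struct_def)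
  qed
  moreover have "hom_family \<Sigma> (prod_struct I A) h s ` carr (prod_struct I A) s = carr (prod_struct J B) s"
    if s: "s \<in> sorts \<Sigma>" for s
  proof
    show "hom_family \<Sigma> (prod_struct I A) h s ` carr (prod_struct I A) s \<subseteq> carr (prod_struct J B) s"
      using Hom_carr[OF hom s] by blast
    show "carr (prod_struct J B) s \<subseteq> hom_family \<Sigma> (prod_struct I A) h s ` carr (prod_struct I A) s"
    proof
      fix y assume y: "y \<in> carr (prod_struct J B) s"
      define x where "x = (\<lambda>i\<in>I. let j = inv_into J b i in inv_into (carr (A i) s) (k j s) (y j))"
      have val: "k j s (x (b j)) = y j" "x (b j) \<in> carr (A (b j)) s" if j: "j \<in> J" for j
      proof -
        have "y j \<in> k j s ` carr (A (b j)) s"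
          using y j im[OF j s] by (auto simp: prod_struct_def PiE_iff)
        moreover have "x (b j) = inv_into (carr (A (b j)) s) (k j s) (y j)"
          using j bI b by (simp add: x_def bij_betw_def)
        ultimately show "k j s (x (b j)) = y j" "x (b j) \<in> carr (A (b j)) s"
          by (simp_all add: f_inv_into_f inv_into_into)
      qed
      have "x i \<in> carr (A i) s" if "i \<in> I" for i using Ib[OF that] val(2) by blast
      moreover have "x \<in> extensional I" by (simp add: x_def)
      ultimately have "x \<in> carr (prod_struct I A) s" by (simp add: prod_struct_def PiE_iff)
      moreover have "h s x = y"
        using val(1) y by (auto simp: h_def prod_struct_def PiE_iff extensional_def)
      ultimately show "y \<in> hom_family \<Sigma> (prod_struct I A) h s ` carr (prod_struct I A) s"
        using s by (metis hom_family_apply imageI)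
    qed
  qed
  ultimately show ?thesis
    unfolding isomorphic_def embedding_def
    using rint by (metis map2_hom_family signature_sorts(3)[OF sig])
qed

lemma embedding_image:
  assumes sig: "is_signature \<Sigma>" and A: "is_struct \<Sigma> A" and C: "is_struct \<Sigma> C"
    and h: "embedding \<Sigma> A C h"
  obtains B where "substructure \<Sigma> B C" "isomorphic \<Sigma> A B"
proof -
  have H: "h \<in> Hom \<Sigma> A C" using h by (simp add: embedding_def)
  define B where "B = \<lparr>carr = (\<lambda>s. h s ` carr A s), fint = fint C, rint = rint C\<rparr>"
  have img: "\<exists>xs\<in>tuples A ss. ys = map2 h ss xs" if "ys \<in> tuples B ss" for ys ss
  proof -
    have "list_all2 (\<lambda>y s. y \<in> carr B s) ys ss" using that by (simp add: tuples_def)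
    then have "\<exists>xs. list_all2 (\<lambda>x s. x \<in> carr A s) xs ss \<and> ys = map2 h ss xs"
    proof (induction rule: list_all2_induct)
      case (Cons y ys s ss)
      then obtain xs a where "list_all2 (\<lambda>x s. x \<in> carr A s) xs ss" "ys = map2 h ss xs"
          "a \<in> carr A s" "y = h s a" by (auto simp: B_def)
      then show ?case by (intro exI[of _ "a # xs"]) auto
    qed simp
    then show ?thesis by (auto simp: tuples_def)
  qed
  have "is_struct \<Sigma> B"
    unfolding is_struct_def
  proof (intro ballI)
    fix f ys assume f: "f \<in> funs \<Sigma>" and "ys \<in> tuples B (fun_dom \<Sigma> f)"
    then obtain xs where xs: "xs \<in> tuples A (fun_dom \<Sigma> f)" "ys = map2 h (fun_dom \<Sigma> f) xs"
      using img by blast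
    then have "fint C f ys = h (fun_cod \<Sigma> f) (fint A f xs)" using Hom_fint[OF H f] by simp
    moreover have "fint A f xs \<in> carr A (fun_cod \<Sigma> f)" using A f xs unfolding is_struct_def by blast
    ultimately show "fint B f ys \<in> carr B (fun_cod \<Sigma> f)" by (auto simp: B_def)
  qed
  then have "substructure \<Sigma> B C"
    using C Hom_carr[OF H] by (auto simp: substructure_def B_def)
  moreover have "embedding \<Sigma> A B h"
    using h unfolding embedding_def Hom_def B_def by (auto simp: PiE_iff)
  then have "isomorphic \<Sigma> A B" unfolding isomorphic_def by (auto simp: B_def)
  ultimately show ?thesis using that by blast
qed

lemma embedding_substructure:
  assumes sig: "is_signature \<Sigma>" and "substructure \<Sigma> B A"
  shows "embedding \<Sigma> B A (hom_family \<Sigma> B (\<lambda>s a. a))"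
proof -
  have "is_struct \<Sigma> B" using assms by (simp add: substructure_def)
  then have "hom_family \<Sigma> B (\<lambda>s a. a) \<in> Hom \<Sigma> B A"
    using assms(2) by (intro hom_family_in_Hom[OF sig]) (auto simp: substructure_def map2_tuples_id)
  then show ?thesis
    using assms(2) signature_sorts(3)[OF sig]
    by (auto simp: embedding_def substructure_def inj_on_def map2_hom_family map2_tuples_id)
qed

section \<open>Structures separated by their homomorphisms to a fixed structure\<close>

text \<open>
  The condition below says exactly that evaluation embeds \<open>A\<close> into a power of \<open>C\<close>, but its
  two clauses ask for one homomorphism at a time. This makes its closure properties and its
  consequences for Horn clauses accessible without any calculation in powers.
\<close>

definition separated :: "'u signature \<Rightarrow> ('u, 'a) struct \<Rightarrow> ('u, 'b) struct \<Rightarrow> bool" where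
  "separated \<Sigma> A C \<longleftrightarrow>
     (\<forall>s\<in>sorts \<Sigma>. \<forall>a\<in>carr A s. \<forall>b\<in>carr A s. a \<noteq> b \<longrightarrow> (\<exists>h\<in>Hom \<Sigma> A C. h s a \<noteq> h s b)) \<and>
     (\<forall>r\<in>rels \<Sigma>. \<forall>xs\<in>tuples A (rel_dom \<Sigma> r). \<not> rint A r xs \<longrightarrow>
        (\<exists>h\<in>Hom \<Sigma> A C. \<not> rint C r (map2 h (rel_dom \<Sigma> r) xs)))"

lemma separated_points:
  "separated \<Sigma> A C \<Longrightarrow> s \<in> sorts \<Sigma> \<Longrightarrow> a \<in> carr A s \<Longrightarrow> b \<in> carr A s \<Longrightarrow> a \<noteq> b \<Longrightarrow>
   \<exists>h\<in>Hom \<Sigma> A C. h s a \<noteq> h s b"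
  unfolding separated_def by blast

lemma separated_relations:
  "separated \<Sigma> A C \<Longrightarrow> r \<in> rels \<Sigma> \<Longrightarrow> xs \<in> tuples A (rel_dom \<Sigma> r) \<Longrightarrow> \<not> rint A r xs \<Longrightarrow>
   \<exists>h\<in>Hom \<Sigma> A C. \<not> rint C r (map2 h (rel_dom \<Sigma> r) xs)"
  unfolding separated_def by blast

text \<open>
  If two elements or a failing relation of \<open>A\<close> can be told apart in one of several separated
  structures \<open>B i\<close>, then composition with a separating homomorphism of \<open>B i\<close> tells them apart
  in \<open>C\<close>.
\<close>

lemma separated_family:
  assumes sig: "is_signature \<Sigma>" and A: "is_struct \<Sigma> A"
    and g: "\<And>i. i \<in> I \<Longrightarrow> g i \<in> Hom \<Sigma> A (B i)" and B: "\<And>i. i \<in> I \<Longrightarrow> separated \<Sigma> (B i) C"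
    and pts: "\<And>s a b. s \<in> sorts \<Sigma> \<Longrightarrow> a \<in> carr A s \<Longrightarrow> b \<in> carr A s \<Longrightarrow> a \<noteq> b \<Longrightarrow>
      \<exists>i\<in>I. g i s a \<noteq> g i s b"
    and rls: "\<And>r xs. r \<in> rels \<Sigma> \<Longrightarrow> xs \<in> tuples A (rel_dom \<Sigma> r) \<Longrightarrow> \<not> rint A r xs \<Longrightarrow>
      \<exists>i\<in>I. \<not> rint (B i) r (map2 (g i) (rel_dom \<Sigma> r) xs)"
  shows "separated \<Sigma> A C"
  unfolding separated_def
proof (intro conjI ballI impI)
  fix s a b assume s: "s \<in> sorts \<Sigma>" and ab: "a \<in> carr A s" "b \<in> carr A s" "a \<noteq> b"
  then obtain i where i: "i \<in> I" "g i s a \<noteq> g i s b" using pts by blast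
  then obtain h where h: "h \<in> Hom \<Sigma> (B i) C" "h s (g i s a) \<noteq> h s (g i s b)"
    using B[OF i(1)] s Hom_carr[OF g[OF i(1)] s] ab unfolding separated_def by blast
  then show "\<exists>h\<in>Hom \<Sigma> A C. h s a \<noteq> h s b"
    using s ab by (intro bexI[OF _ Hom_compose[OF sig A g[OF i(1)] h(1)]]) simp
next
  fix r xs assume r: "r \<in> rels \<Sigma>" and xs: "xs \<in> tuples A (rel_dom \<Sigma> r)" "\<not> rint A r xs"
  note ss = signature_sorts(3)[OF sig r]
  obtain i where i: "i \<in> I" "\<not> rint (B i) r (map2 (g i) (rel_dom \<Sigma> r) xs)" using rls r xs by blast
  then obtain h where h: "h \<in> Hom \<Sigma> (B i) C"
      "\<not> rint C r (map2 h (rel_dom \<Sigma> r) (map2 (g i) (rel_dom \<Sigma> r) xs))"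
    using B[OF i(1)] r Hom_tuples[OF g[OF i(1)] ss xs(1)] unfolding separated_def by blast
  then show "\<exists>h\<in>Hom \<Sigma> A C. \<not> rint C r (map2 h (rel_dom \<Sigma> r) xs)"
    using ss xs(1)
    by (intro bexI[OF _ Hom_compose[OF sig A g[OF i(1)] h(1)]]) (simp add: map2_hom_family map2_map2)
qed

lemma separated_self:
  assumes "is_signature \<Sigma>" "is_struct \<Sigma> C"
  shows "separated \<Sigma> C C"
proof -
  have "map2 (hom_family \<Sigma> C (\<lambda>s a. a)) (rel_dom \<Sigma> r) xs = xs"
    if "r \<in> rels \<Sigma>" "xs \<in> tuples C (rel_dom \<Sigma> r)" for r xs
    using that signature_sorts(3)[OF assms(1)] by (simp add: map2_hom_family map2_tuples_id)
  then show ?thesis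
    unfolding separated_def using Hom_id[OF assms]
    by (metis hom_family_apply)
qed

lemma separated_embedding:
  assumes "is_signature \<Sigma>" "is_struct \<Sigma> A" "embedding \<Sigma> A B g" "separated \<Sigma> B C"
  shows "separated \<Sigma> A C"
  using assms by (intro separated_family[of \<Sigma> A "{()}" "\<lambda>_. g" "\<lambda>_. B"])
    (auto simp: embedding_def dest: inj_onD)

lemma separated_prod:
  assumes sig: "is_signature \<Sigma>" and A: "\<And>i. i \<in> I \<Longrightarrow> is_struct \<Sigma> (A i)"
    and sep: "\<And>i. i \<in> I \<Longrightarrow> separated \<Sigma> (A i) C"
  shows "separated \<Sigma> (prod_struct I A) C"
proof -
  have P: "is_struct \<Sigma> (prod_struct I A)" using is_struct_prod A by blast
  show ?thesis
  proof (rule separated_family[OF sig P Hom_prod_proj[OF sig P] sep])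
    fix s x y assume s: "s \<in> sorts \<Sigma>" and x: "x \<in> carr (prod_struct I A) s"
      and y: "y \<in> carr (prod_struct I A) s" and "x \<noteq> y"
    then have "\<exists>i\<in>I. x i \<noteq> y i"
      using PiE_ext[of x I "\<lambda>i. carr (A i) s" y] by (auto simp: prod_struct_def)
    then show "\<exists>i\<in>I. hom_family \<Sigma> (prod_struct I A) (\<lambda>s x. x i) s x
        \<noteq> hom_family \<Sigma> (prod_struct I A) (\<lambda>s x. x i) s y" using s x y by simp
  next
    fix r xs assume r: "r \<in> rels \<Sigma>" and xs: "xs \<in> tuples (prod_struct I A) (rel_dom \<Sigma> r)"
      and "\<not> rint (prod_struct I A) r xs"
    then obtain i where i: "i \<in> I" "\<not> rint (A i) r (map (\<lambda>x. x i) xs)" by (auto simp: prod_struct_def)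
    moreover have "map2 (\<lambda>s x. x i) (rel_dom \<Sigma> r) xs = map (\<lambda>x. x i) xs"
      using xs by (auto simp: tuples_def list_all2_lengthD intro!: nth_equalityI)
    ultimately show "\<exists>i\<in>I. \<not> rint (A i) r
        (map2 (hom_family \<Sigma> (prod_struct I A) (\<lambda>s x. x i)) (rel_dom \<Sigma> r) xs)"
      unfolding map2_hom_family[OF signature_sorts(3)[OF sig r] xs] by metis
  qed
qed

lemma separated_imp_evaluation_embedding:
  assumes sig: "is_signature \<Sigma>" and A: "is_struct \<Sigma> A" and sep: "separated \<Sigma> A C"
  shows "embedding \<Sigma> A (prod_struct (Hom \<Sigma> A C) (\<lambda>_. C)) (\<lambda>s\<in>sorts \<Sigma>. \<lambda>a\<in>carr A s. \<lambda>\<phi>\<in>Hom \<Sigma> A C. \<phi> s a)"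
proof -
  let ?H = "Hom \<Sigma> A C" and ?P = "prod_struct (Hom \<Sigma> A C) (\<lambda>_. C)"
  define h where "h s a = (\<lambda>\<phi>\<in>?H. \<phi> s a)" for s a
  have comp: "map (\<lambda>x. x \<phi>) (map2 h ss xs) = map2 \<phi> ss xs" if "\<phi> \<in> ?H" for \<phi> ss xs
    using that by (auto simp: h_def)
  have rint: "rint ?P r (map2 h (rel_dom \<Sigma> r) xs) \<longleftrightarrow> rint A r xs"
    if "r \<in> rels \<Sigma>" "xs \<in> tuples A (rel_dom \<Sigma> r)" for r xs
  proof -
    have "rint ?P r (map2 h (rel_dom \<Sigma> r) xs) \<longleftrightarrow> (\<forall>\<phi>\<in>?H. rint C r (map2 \<phi> (rel_dom \<Sigma> r) xs))"
      by (simp add: prod_struct_def comp del: map_map)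
    also have "\<dots> \<longleftrightarrow> rint A r xs"
      using that sep Hom_rint[of _ \<Sigma> A C r xs] unfolding separated_def by blast
    finally show ?thesis .
  qed
  have "hom_family \<Sigma> A h \<in> Hom \<Sigma> A ?P"
  proof (rule hom_family_in_Hom[OF sig A])
    show "h s a \<in> carr ?P s" if "s \<in> sorts \<Sigma>" "a \<in> carr A s" for s a
      using Hom_carr[OF _ that] by (auto simp: h_def prod_struct_def)
    show "h (fun_cod \<Sigma> f) (fint A f xs) = fint ?P f (map2 h (fun_dom \<Sigma> f) xs)"
      if "f \<in> funs \<Sigma>" "xs \<in> tuples A (fun_dom \<Sigma> f)" for f xs
      using Hom_fint[OF _ that]
      by (auto simp: prod_struct_def comp h_def[of "fun_cod \<Sigma> f"] simp del: map_map intro!: restrict_ext)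
  qed (use rint in auto)
  moreover have "inj_on (hom_family \<Sigma> A h s) (carr A s)" if s: "s \<in> sorts \<Sigma>" for s
  proof (rule inj_onI, rule ccontr)
    fix a b assume ab: "a \<in> carr A s" "b \<in> carr A s" "hom_family \<Sigma> A h s a = hom_family \<Sigma> A h s b" "a \<noteq> b"
    then obtain \<phi> where "\<phi> \<in> ?H" "\<phi> s a \<noteq> \<phi> s b" using sep s unfolding separated_def by blast
    then show False using ab s by (auto simp: h_def dest: fun_cong[of _ _ \<phi>])
  qed
  ultimately have "embedding \<Sigma> A ?P (hom_family \<Sigma> A h)"
    unfolding embedding_def using rint signature_sorts(3)[OF sig] by (simp add: map2_hom_family)
  then show ?thesis unfolding hom_family_def h_def .
qed

section \<open>Horn clauses\<close>

lemma map2_map_sort_of: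
  "map2 h (map (sort_of \<Sigma>) ts) (map v ts) = map (\<lambda>t. h (sort_of \<Sigma> t) (v t)) ts"
  by (induction ts) auto

lemma val_carr:
  assumes A: "is_struct \<Sigma> A"
  shows "is_trm \<Sigma> t \<Longrightarrow> (\<And>x. x \<in> trm_vars t \<Longrightarrow> e x \<in> carr A (snd x)) \<Longrightarrow> val A e t \<in> carr A (sort_of \<Sigma> t)"
proof (induction t)
  case (App f ts)
  have "val A e t \<in> carr A (sort_of \<Sigma> t)" if "t \<in> set ts" for t
    using App.prems that by (intro App.IH) auto
  then have "list_all2 (\<lambda>x s. x \<in> carr A s) (map (val A e) ts) (map (sort_of \<Sigma>) ts)"
    by (simp add: list.rel_map list_all2_same)
  then have "map (val A e) ts \<in> tuples A (fun_dom \<Sigma> f)" using App.prems(1) by (simp add: tuples_def)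
  then show ?case using A App.prems(1) by (simp add: is_struct_def)
qed simp

lemma vals_tuples:
  assumes A: "is_struct \<Sigma> A"
    and "\<And>t. t \<in> set ts \<Longrightarrow> is_trm \<Sigma> t" and "\<And>t x. t \<in> set ts \<Longrightarrow> x \<in> trm_vars t \<Longrightarrow> e x \<in> carr A (snd x)"
  shows "map (val A e) ts \<in> tuples A (map (sort_of \<Sigma>) ts)"
proof -
  have "val A e t \<in> carr A (sort_of \<Sigma> t)" if "t \<in> set ts" for t
    using assms(2,3)[OF that] by (rule val_carr[OF A])
  then show ?thesis unfolding tuples_def by (simp add: list.rel_map list_all2_same)
qed

lemma val_cong: "(\<And>x. x \<in> trm_vars t \<Longrightarrow> e x = e' x) \<Longrightarrow> val A e t = val A e' t"
proof (induction t)
  case (App f ts)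
  then have "map (val A e) ts = map (val A e') ts" by auto
  then show ?case by (simp only: val.simps)
qed simp

lemma sat_cong: "(\<And>x. x \<in> free_vars \<phi> \<Longrightarrow> e x = e' x) \<Longrightarrow> sat A e \<phi> \<longleftrightarrow> sat A e' \<phi>"
proof (induction \<phi> arbitrary: e e')
  case (Eq t u)
  then show ?case using val_cong[of t e e' A] val_cong[of u e e' A] by simp
next
  case (Rel r ts)
  then have "map (val A e) ts = map (val A e') ts" by (auto intro!: val_cong)
  then show ?case by (simp only: sat.simps)
next
  case (Conj \<phi> \<psi>)
  show ?case using Conj.IH(1)[of e e'] Conj.IH(2)[of e e'] Conj.prems by simp
next
  case (Imp \<phi> \<psi>)
  show ?case using Imp.IH(1)[of e e'] Imp.IH(2)[of e e'] Imp.prems by simp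
next
  case (All x \<phi>)
  have "sat A (e(x := a)) \<phi> \<longleftrightarrow> sat A (e'(x := a)) \<phi>" for a
    using All.prems by (intro All.IH) simp
  then show ?case by simp
qed simp

lemma val_Hom:
  assumes A: "is_struct \<Sigma> A" and h: "h \<in> Hom \<Sigma> A B"
  shows "is_trm \<Sigma> t \<Longrightarrow> (\<And>x. x \<in> trm_vars t \<Longrightarrow> e x \<in> carr A (snd x)) \<Longrightarrow>
    val B (\<lambda>x. h (snd x) (e x)) t = h (sort_of \<Sigma> t) (val A e t)"
proof (induction t)
  case (App f ts)
  have "map (val A e) ts \<in> tuples A (fun_dom \<Sigma> f)"
    using vals_tuples[OF A, of ts e] App.prems by fastforce
  then have "h (fun_cod \<Sigma> f) (fint A f (map (val A e) ts))
      = fint B f (map (\<lambda>t. h (sort_of \<Sigma> t) (val A e t)) ts)"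
    using Hom_fint[OF h] App.prems(1) map2_map_sort_of[of h \<Sigma> ts "val A e"] by simp
  moreover have "map (val B (\<lambda>x. h (snd x) (e x))) ts = map (\<lambda>t. h (sort_of \<Sigma> t) (val A e t)) ts"
    using App by auto
  ultimately show ?case by (simp only: val.simps sort_of.simps)
qed simp

lemma sat_foldr_All:
  "distinct xs \<Longrightarrow> sat A e (foldr All xs \<phi>) \<longleftrightarrow>
    (\<forall>e'. (\<forall>x\<in>set xs. e' x \<in> carr A (snd x)) \<and> (\<forall>x. x \<notin> set xs \<longrightarrow> e' x = e x) \<longrightarrow> sat A e' \<phi>)"
proof (induction xs arbitrary: e)
  case Nil
  have "e' = e" if "\<forall>x. e' x = e x" for e' using that by auto
  then show ?case by auto
next
  case (Cons y xs)
  show ?case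
  proof
    assume L: "sat A e (foldr All (y # xs) \<phi>)"
    show "\<forall>e'. (\<forall>x\<in>set (y # xs). e' x \<in> carr A (snd x)) \<and> (\<forall>x. x \<notin> set (y # xs) \<longrightarrow> e' x = e x) \<longrightarrow> sat A e' \<phi>"
    proof (intro allI impI)
      fix e' assume e': "(\<forall>x\<in>set (y # xs). e' x \<in> carr A (snd x)) \<and> (\<forall>x. x \<notin> set (y # xs) \<longrightarrow> e' x = e x)"
      then have "sat A (e(y := e' y)) (foldr All xs \<phi>)" using L by simp
      then show "sat A e' \<phi>" using Cons e' by simp
    qed
  next
    assume R: "\<forall>e'. (\<forall>x\<in>set (y # xs). e' x \<in> carr A (snd x)) \<and> (\<forall>x. x \<notin> set (y # xs) \<longrightarrow> e' x = e x) \<longrightarrow> sat A e' \<phi>"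
    have "sat A (e(y := a)) (foldr All xs \<phi>)" if a: "a \<in> carr A (snd y)" for a
    proof -
      have "sat A e' \<phi>" if 1: "\<forall>x\<in>set xs. e' x \<in> carr A (snd x)"
        and 2: "\<forall>x. x \<notin> set xs \<longrightarrow> e' x = (e(y := a)) x" for e'
      proof -
        have "e' y = a" using 2[rule_format, of y] Cons.prems by simp
        moreover have "e' x = e x" if "x \<notin> set (y # xs)" for x using 2[rule_format, of x] that by simp
        ultimately show ?thesis using R[rule_format, of e'] 1 a by simp
      qed
      then show ?thesis using Cons by auto
    qed
    then show "sat A e (foldr All (y # xs) \<phi>)" by simp
  qed
qed

lemma sat_BigConj: "sat A e (BigConj \<phi>s) \<longleftrightarrow> (\<forall>\<phi>\<in>set \<phi>s. sat A e \<phi>)"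
  by (induction \<phi>s) (auto simp: BigConj_def)

lemma free_vars_BigConj: "free_vars (BigConj \<phi>s) = (\<Union>\<phi>\<in>set \<phi>s. free_vars \<phi>)"
  by (induction \<phi>s) (auto simp: BigConj_def)

lemma is_fm_BigConj: "is_fm \<Sigma> (BigConj \<phi>s) \<longleftrightarrow> (\<forall>\<phi>\<in>set \<phi>s. is_fm \<Sigma> \<phi>)"
  by (induction \<phi>s) (auto simp: BigConj_def)

lemma trm_vars_sorts: "is_trm \<Sigma> t \<Longrightarrow> x \<in> trm_vars t \<Longrightarrow> snd x \<in> sorts \<Sigma>"
  by (induction t) auto

lemma free_vars_sorts: "is_fm \<Sigma> \<phi> \<Longrightarrow> x \<in> free_vars \<phi> \<Longrightarrow> snd x \<in> sorts \<Sigma>"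
  by (induction \<phi>) (auto dest: trm_vars_sorts)

lemma finite_trm_vars: "finite (trm_vars t)"
  by (induction t) auto

lemma finite_free_vars: "finite (free_vars \<phi>)"
  by (induction \<phi>) (auto simp: finite_trm_vars)

lemma holds_horn_clause:
  assumes "distinct xs"
  shows "holds A (foldr All xs (Imp (BigConj \<phi>s) \<psi>)) \<longleftrightarrow>
    (\<forall>e. (\<forall>x\<in>set xs. e x \<in> carr A (snd x)) \<longrightarrow> (\<forall>\<phi>\<in>set \<phi>s. sat A e \<phi>) \<longrightarrow> sat A e \<psi>)"
proof
  assume *: "holds A (foldr All xs (Imp (BigConj \<phi>s) \<psi>))"
  show "\<forall>e. (\<forall>x\<in>set xs. e x \<in> carr A (snd x)) \<longrightarrow> (\<forall>\<phi>\<in>set \<phi>s. sat A e \<phi>) \<longrightarrow> sat A e \<psi>"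
  proof (intro allI impI)
    fix e assume "\<forall>x\<in>set xs. e x \<in> carr A (snd x)" "\<forall>\<phi>\<in>set \<phi>s. sat A e \<phi>"
    moreover have "sat A e (foldr All xs (Imp (BigConj \<phi>s) \<psi>))" using * by (simp add: holds_def)
    ultimately show "sat A e \<psi>"
      unfolding sat_foldr_All[OF assms] by (simp add: sat_BigConj)
  qed
next
  assume "\<forall>e. (\<forall>x\<in>set xs. e x \<in> carr A (snd x)) \<longrightarrow> (\<forall>\<phi>\<in>set \<phi>s. sat A e \<phi>) \<longrightarrow> sat A e \<psi>"
  then show "holds A (foldr All xs (Imp (BigConj \<phi>s) \<psi>))"
    unfolding holds_def sat_foldr_All[OF assms] by (simp add: sat_BigConj)
qed

lemma horn_clauses_sentences: "horn_clauses \<Sigma> \<subseteq> sentences \<Sigma>"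
proof
  fix \<chi> assume "\<chi> \<in> horn_clauses \<Sigma>"
  then obtain xs \<phi>s \<psi> where \<chi>: "\<chi> = foldr All xs (Imp (BigConj \<phi>s) \<psi>)"
    and fm: "is_fm \<Sigma> (Imp (BigConj \<phi>s) \<psi>)" and xs: "set xs = free_vars (Imp (BigConj \<phi>s) \<psi>)"
    unfolding horn_clauses_def by (auto simp: is_fm_BigConj)
  have "is_fm \<Sigma> (foldr All ys \<phi>)" if "is_fm \<Sigma> \<phi>" "\<forall>y\<in>set ys. snd y \<in> sorts \<Sigma>" for ys \<phi>
    using that by (induction ys) auto
  moreover have "free_vars (foldr All ys \<phi>) = free_vars \<phi> - set ys" for ys and \<phi> :: "'a fm"
    by (induction ys) auto
  ultimately show "\<chi> \<in> sentences \<Sigma>"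
    using fm xs free_vars_sorts[OF fm] unfolding \<chi> sentences_def by blast
qed

text \<open>
  A counterexample to a Horn clause in \<open>A\<close> makes one atom fail. A homomorphism to \<open>C\<close> under
  which this atom still fails preserves all the hypotheses, since they are atomic, and so carries
  the counterexample to \<open>C\<close>.
\<close>

lemma horn_clause_separated:
  assumes sig: "is_signature \<Sigma>" and A: "is_struct \<Sigma> A" and sep: "separated \<Sigma> A C"
    and \<chi>: "\<chi> \<in> horn_clauses \<Sigma>" "holds C \<chi>"
  shows "holds A \<chi>"
proof -
  obtain xs \<phi>s \<psi> where \<chi>_def: "\<chi> = foldr All xs (Imp (BigConj \<phi>s) \<psi>)"
    and at: "\<And>\<phi>. \<phi> \<in> insert \<psi> (set \<phi>s) \<Longrightarrow> atomic \<phi> \<and> is_fm \<Sigma> \<phi>"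
    and xs: "distinct xs" "set xs = free_vars (Imp (BigConj \<phi>s) \<psi>)"
    using \<chi>(1) unfolding horn_clauses_def by auto
  have "sat A e \<psi>" if e: "\<forall>x\<in>set xs. e x \<in> carr A (snd x)" and hyp: "\<forall>\<phi>\<in>set \<phi>s. sat A e \<phi>" for e
  proof (rule ccontr)
    assume neg: "\<not> sat A e \<psi>"
    have vars: "e x \<in> carr A (snd x)" if "x \<in> free_vars \<phi>" "\<phi> \<in> insert \<psi> (set \<phi>s)" for x \<phi>
      using e that unfolding xs(2) by (auto simp: free_vars_BigConj)
    have vt: "map (val A e) ts \<in> tuples A (rel_dom \<Sigma> r)" if "Rel r ts \<in> insert \<psi> (set \<phi>s)" for r ts
      using vals_tuples[OF A, of ts e] vars[OF _ that] at[OF that] by auto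
    have vh: "map (val C (\<lambda>x. h (snd x) (e x))) ts = map2 h (rel_dom \<Sigma> r) (map (val A e) ts)"
      if h: "h \<in> Hom \<Sigma> A C" and mem: "Rel r ts \<in> insert \<psi> (set \<phi>s)" for h r ts
    proof -
      have "val C (\<lambda>x. h (snd x) (e x)) t = h (sort_of \<Sigma> t) (val A e t)" if t: "t \<in> set ts" for t
        using vars[OF _ mem] at[OF mem] t by (intro val_Hom[OF A h]) auto
      then show ?thesis using at[OF mem] map2_map_sort_of[of h \<Sigma> ts "val A e"] by simp
    qed
    obtain h where h: "h \<in> Hom \<Sigma> A C" and nh: "\<not> sat C (\<lambda>x. h (snd x) (e x)) \<psi>"
    proof (cases "\<exists>t u. \<psi> = Eq t u")
      case True
      then obtain t u where \<psi>: "\<psi> = Eq t u" by blast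
      then have tu: "is_trm \<Sigma> t" "is_trm \<Sigma> u" "sort_of \<Sigma> t = sort_of \<Sigma> u" using at[of \<psi>] by auto
      have "\<And>x. x \<in> trm_vars t \<Longrightarrow> e x \<in> carr A (snd x)" "\<And>x. x \<in> trm_vars u \<Longrightarrow> e x \<in> carr A (snd x)"
        using vars[of _ \<psi>] by (auto simp: \<psi>)
      note vtu = this
      have "sort_of \<Sigma> t \<in> sorts \<Sigma>"
        using tu(1) signature_sorts(2)[OF sig] by (cases t) auto
      then obtain h where h: "h \<in> Hom \<Sigma> A C"
        and ne: "h (sort_of \<Sigma> t) (val A e t) \<noteq> h (sort_of \<Sigma> t) (val A e u)"
        using separated_points[OF sep _ val_carr[OF A tu(1) vtu(1)], of "val A e u"]
          val_carr[OF A tu(2) vtu(2)] tu(3) neg by (auto simp: \<psi>)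
      then show ?thesis
        using val_Hom[OF A h tu(1) vtu(1)] val_Hom[OF A h tu(2) vtu(2)] tu(3)
        by (intro that[OF h]) (simp add: \<psi>)
    next
      case False
      then obtain r ts where \<psi>: "\<psi> = Rel r ts" using at[of \<psi>] unfolding atomic_def by blast
      then obtain h where h: "h \<in> Hom \<Sigma> A C" "\<not> rint C r (map2 h (rel_dom \<Sigma> r) (map (val A e) ts))"
        using separated_relations[OF sep _ vt, of r ts] neg at[of \<psi>] by auto
      then show ?thesis using vh[OF h(1), of r ts] by (intro that[OF h(1)]) (simp add: \<psi>)
    qed
    have "sat C (\<lambda>x. h (snd x) (e x)) \<phi>" if \<phi>: "\<phi> \<in> set \<phi>s" for \<phi>
    proof (cases "\<exists>t u. \<phi> = Eq t u")
      case True
      then obtain t u where tu: "\<phi> = Eq t u" by blast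
      then have "val A e t = val A e u" using hyp \<phi> by auto
      then show ?thesis
        using val_Hom[OF A h, of t e] val_Hom[OF A h, of u e] vars[of _ \<phi>] \<phi> at[of \<phi>] by (simp add: tu)
    next
      case False
      then obtain r ts where rts: "\<phi> = Rel r ts" using at[of \<phi>] \<phi> unfolding atomic_def by blast
      then have "rint A r (map (val A e) ts)" "r \<in> rels \<Sigma>" using hyp \<phi> at[of \<phi>] by auto
      then show ?thesis
        using Hom_rint[OF h _ vt] vh[OF h, of r ts] \<phi> by (simp add: rts)
    qed
    moreover have "\<forall>x\<in>set xs. h (snd x) (e x) \<in> carr C (snd x)"
      using e Hom_carr[OF h] free_vars_sorts[of \<Sigma> "Imp (BigConj \<phi>s) \<psi>"] at
      unfolding xs(2) by (simp add: is_fm_BigConj)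
    ultimately have "sat C (\<lambda>x. h (snd x) (e x)) \<psi>"
      using \<chi>(2) unfolding \<chi>_def holds_horn_clause[OF xs(1)] by simp
    then show False using nh by contradiction
  qed
  then show ?thesis unfolding \<chi>_def holds_horn_clause[OF xs(1)] by blast
qed

section \<open>Local homomorphisms\<close>

text \<open>
  The elements, the function symbols and the relation symbols of a structure are collected in one
  set, so that a single finite subset can select finitely many of each.
\<close>

definition ingredients :: "'u signature \<Rightarrow> ('u, 'a) struct \<Rightarrow> (('u \<times> 'a) + 'u + 'u) set" where
  "ingredients \<Sigma> A = (SIGMA s:sorts \<Sigma>. carr A s) <+> (funs \<Sigma> <+> rels \<Sigma>)"

definition local_hom :: "'u signature \<Rightarrow> ('u, 'a) struct \<Rightarrow> ('u, 'b) struct \<Rightarrow>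
    (('u \<times> 'a) + 'u + 'u) set \<Rightarrow> ('u \<Rightarrow> 'a \<Rightarrow> 'b) \<Rightarrow> bool" where
  "local_hom \<Sigma> A C D g \<longleftrightarrow>
     (\<forall>s a. Inl (s, a) \<in> D \<longrightarrow> g s a \<in> carr C s) \<and>
     (\<forall>f xs. Inr (Inl f) \<in> D \<longrightarrow> xs \<in> tuples A (fun_dom \<Sigma> f) \<longrightarrow>
        Inl ` set (zip (fun_dom \<Sigma> f) xs) \<subseteq> D \<longrightarrow> Inl (fun_cod \<Sigma> f, fint A f xs) \<in> D \<longrightarrow>
        g (fun_cod \<Sigma> f) (fint A f xs) = fint C f (map2 g (fun_dom \<Sigma> f) xs)) \<and>
     (\<forall>r xs. Inr (Inr r) \<in> D \<longrightarrow> xs \<in> tuples A (rel_dom \<Sigma> r) \<longrightarrow>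
        Inl ` set (zip (rel_dom \<Sigma> r) xs) \<subseteq> D \<longrightarrow> rint A r xs \<longrightarrow>
        rint C r (map2 g (rel_dom \<Sigma> r) xs))"

lemma local_hom_mono: "local_hom \<Sigma> A C D' g \<Longrightarrow> D \<subseteq> D' \<Longrightarrow> local_hom \<Sigma> A C D g"
  unfolding local_hom_def by (meson subset_eq)

text \<open>
  This is where the Horn theory enters. With a variable \<open>v p\<close> for each of the finitely many
  elements \<open>p\<close> in \<open>D\<close>, the part of the positive diagram of \<open>A\<close> visible in \<open>D\<close> is a finite set
  of atoms. If the atom \<open>\<psi>\<close> fails in \<open>A\<close>, the Horn clause from these atoms to \<open>\<psi>\<close> fails in \<open>A\<close>,
  hence also in \<open>C\<close>, and a counterexample in \<open>C\<close> is the required map.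

  The atoms \<open>v p = v p\<close> are included in the hypotheses to make each \<open>v p\<close> a variable of the
  clause: a sort may be empty in \<open>C\<close>, and only the variables of a clause receive values in \<open>C\<close>.
\<close>

lemma horn_theory_local_hom:
  fixes A :: "('u, 'a) struct" and C :: "('u, 'b) struct"
  assumes horn: "\<forall>\<chi>\<in>horn_theory \<Sigma> C. holds A \<chi>"
    and D: "finite D" "D \<subseteq> ingredients \<Sigma> A"
    and E_def: "E = {p. Inl p \<in> D}"
    and v: "inj_on v E" "\<And>p. p \<in> E \<Longrightarrow> snd (v p) = fst p"
    and \<psi>: "atomic \<psi>" "is_fm \<Sigma> \<psi>" "free_vars \<psi> \<subseteq> v ` E"
    and neg: "\<not> sat A (\<lambda>x. snd (inv_into E v x)) \<psi>"
  obtains g where "local_hom \<Sigma> A C D g" "\<not> sat C (\<lambda>x. g (snd x) (snd (inv_into E v x))) \<psi>"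
proof -
  define e where "e x = snd (inv_into E v x)" for x
  have ev: "e (v p) = snd p" if "p \<in> E" for p using v(1) that by (simp add: e_def)
  have E_carr: "fst p \<in> sorts \<Sigma>" "snd p \<in> carr A (fst p)" if "p \<in> E" for p
    using D(2) that by (auto simp: E_def ingredients_def)
  have fin: "finite E" "finite {f. Inr (Inl f) \<in> D}" "finite {r. Inr (Inr r) \<in> D}"
    unfolding E_def using D(1)
    by (auto intro!: finite_vimageI[of D, unfolded vimage_def] simp: inj_def
        dest: finite_vimageI[of D Inl] finite_vimageI[of D "Inr \<circ> Inl"] finite_vimageI[of D "Inr \<circ> Inr"])
  define X_eq where "X_eq = (\<lambda>p. Eq (Var (v p)) (Var (v p))) ` E"
  define X_fun where "X_fun = (\<lambda>(f, ps, q). Eq (App f (map (Var \<circ> v) ps)) (Var (v q))) `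
    (SIGMA f:{f. Inr (Inl f) \<in> D}. {ps. set ps \<subseteq> E \<and> length ps = length (fun_dom \<Sigma> f)} \<times> E)"
  define X_rel where "X_rel = (\<lambda>(r, ps). Rel r (map (Var \<circ> v) ps)) `
    (SIGMA r:{r. Inr (Inr r) \<in> D}. {ps. set ps \<subseteq> E \<and> length ps = length (rel_dom \<Sigma> r)})"
  define \<Phi> where "\<Phi> = {\<phi> \<in> X_eq \<union> X_fun \<union> X_rel. is_fm \<Sigma> \<phi> \<and> sat A e \<phi>}"
  have "finite \<Phi>"
    using fin unfolding \<Phi>_def X_eq_def X_fun_def X_rel_def
    by (intro finite_subset[OF Collect_restrict] finite_UnI finite_imageI finite_SigmaI finite_cartesian_product
        finite_lists_length_eq)
  then obtain \<phi>s where \<phi>s: "set \<phi>s = \<Phi>" using finite_list by blast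
  have \<Phi>_vars: "free_vars \<phi> \<subseteq> v ` E" if "\<phi> \<in> \<Phi>" for \<phi>
  proof -
    have "\<phi> \<in> X_eq \<or> \<phi> \<in> X_fun \<or> \<phi> \<in> X_rel" using that unfolding \<Phi>_def by blast
    then consider "\<phi> \<in> X_eq" | "\<phi> \<in> X_fun" | "\<phi> \<in> X_rel" by blast
    then show ?thesis
    proof cases
      case 2
      then obtain f ps q where "\<phi> = Eq (App f (map (Var \<circ> v) ps)) (Var (v q))" "set ps \<subseteq> E" "q \<in> E"
        unfolding X_fun_def by auto
      then show ?thesis using image_mono[of "set ps" E v] by (simp add: UNION_singleton_eq_range)
    next
      case 3
      then obtain r ps where "\<phi> = Rel r (map (Var \<circ> v) ps)" "set ps \<subseteq> E"
        unfolding X_rel_def by auto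
      then show ?thesis using image_mono[of "set ps" E v] by (simp add: UNION_singleton_eq_range)
    qed (auto simp: X_eq_def)
  qed
  have \<Phi>_atomic: "atomic \<phi>" if "\<phi> \<in> \<Phi>" for \<phi>
    using that unfolding \<Phi>_def X_eq_def X_fun_def X_rel_def atomic_def by auto
  obtain xs where xs: "set xs = free_vars (Imp (BigConj \<phi>s) \<psi>)" "distinct xs"
    using finite_distinct_list[OF finite_free_vars] by blast
  define \<chi> where "\<chi> = foldr All xs (Imp (BigConj \<phi>s) \<psi>)"
  have \<chi>: "\<chi> \<in> horn_clauses \<Sigma>"
    unfolding horn_clauses_def \<chi>_def using xs \<phi>s \<psi> \<Phi>_atomic \<Phi>_def by blast
  have xs_E: "set xs \<subseteq> v ` E"
    unfolding xs(1) using \<psi>(3) \<Phi>_vars by (auto simp: free_vars_BigConj \<phi>s)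
  have "\<not> holds A \<chi>"
  proof -
    have "e x \<in> carr A (snd x)" if x: "x \<in> set xs" for x
    proof -
      obtain p where "p \<in> E" "x = v p" using xs_E x by blast
      then show ?thesis using E_carr(2) by (simp add: ev v(2))
    qed
    moreover have "\<forall>\<phi>\<in>\<Phi>. sat A e \<phi>" by (simp add: \<Phi>_def)
    moreover have "\<not> sat A e \<psi>" using neg by (simp add: e_def[abs_def])
    ultimately show ?thesis unfolding \<chi>_def holds_horn_clause[OF xs(2)] \<phi>s by blast
  qed
  then have "\<not> holds C \<chi>" using horn \<chi> unfolding horn_theory_def by blast
  then obtain e' where e': "\<And>x. x \<in> set xs \<Longrightarrow> e' x \<in> carr C (snd x)"
    and sat_\<Phi>: "\<And>\<phi>. \<phi> \<in> \<Phi> \<Longrightarrow> sat C e' \<phi>" and nsat: "\<not> sat C e' \<psi>"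
    unfolding \<chi>_def holds_horn_clause[OF xs(2)] \<phi>s by blast
  define g where "g s a = e' (v (s, a))" for s a
  have map2_g: "map2 g ss ys = map (e' \<circ> v) (zip ss ys)" for ss ys by (auto simp: g_def)
  have tuple: "map fst (zip ss ys) = ss" "map snd (zip ss ys) = ys" "length (zip ss ys) = length ss"
    if "ys \<in> tuples A ss" for ss ys
    using that by (auto simp: tuples_def dest: list_all2_lengthD)
  have map_sorts: "map (sort_of \<Sigma> \<circ> (Var \<circ> v)) ps = map fst ps" "map (val A e \<circ> (Var \<circ> v)) ps = map snd ps"
    if "set ps \<subseteq> E" for ps using subsetD[OF that] v(2) ev by (simp_all del: split_paired_All)
  have v_sorts: "\<forall>p\<in>set ps. snd (v p) \<in> sorts \<Sigma>" if "set ps \<subseteq> E" for ps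
    using that v(2) E_carr(1) by (metis subsetD)
  have "local_hom \<Sigma> A C D g"
    unfolding local_hom_def
  proof (intro conjI allI impI)
    fix s a assume "Inl (s, a) \<in> D"
    then have p: "(s, a) \<in> E" by (simp add: E_def)
    then have "Eq (Var (v (s, a))) (Var (v (s, a))) \<in> \<Phi>"
      using v(2)[OF p] E_carr(1)[OF p] by (auto simp: \<Phi>_def X_eq_def)
    then have "v (s, a) \<in> set xs" unfolding xs(1) by (simp add: free_vars_BigConj \<phi>s) (metis UnI1 free_vars.simps(1) insertI1 trm_vars.simps(1))
    then show "g s a \<in> carr C s" using e'[of "v (s, a)"] v(2)[OF p] by (simp add: g_def)
  next
    fix f ys assume f: "Inr (Inl f) \<in> D" and ys: "ys \<in> tuples A (fun_dom \<Sigma> f)"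
      and "Inl ` set (zip (fun_dom \<Sigma> f) ys) \<subseteq> D" and "Inl (fun_cod \<Sigma> f, fint A f ys) \<in> D"
    then have ps: "set (zip (fun_dom \<Sigma> f) ys) \<subseteq> E" and q: "(fun_cod \<Sigma> f, fint A f ys) \<in> E"
      by (auto simp: E_def)
    let ?\<phi> = "Eq (App f (map (Var \<circ> v) (zip (fun_dom \<Sigma> f) ys))) (Var (v (fun_cod \<Sigma> f, fint A f ys)))"
    have "?\<phi> \<in> X_fun" unfolding X_fun_def
      using f ps q tuple(3)[OF ys] by (intro image_eqI[of _ _ "(f, zip (fun_dom \<Sigma> f) ys, (fun_cod \<Sigma> f, fint A f ys))"]) auto
    moreover have "f \<in> funs \<Sigma>" using f D(2) by (auto simp: ingredients_def)
    then have "is_fm \<Sigma> ?\<phi>"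
      using v_sorts[OF ps] v(2)[OF q] E_carr(1)[OF q] map_sorts(1)[OF ps] tuple(1)[OF ys] by simp
    moreover have "sat A e ?\<phi>" using map_sorts(2)[OF ps] tuple(2)[OF ys] ev[OF q] by simp
    ultimately have "sat C e' ?\<phi>" by (intro sat_\<Phi>) (simp add: \<Phi>_def del: is_fm.simps)
    moreover have "val C e' \<circ> (Var \<circ> v) = e' \<circ> v" by auto
    ultimately show "g (fun_cod \<Sigma> f) (fint A f ys) = fint C f (map2 g (fun_dom \<Sigma> f) ys)"
      by (simp add: map2_g g_def[of "fun_cod \<Sigma> f"])
  next
    fix r ys assume r: "Inr (Inr r) \<in> D" and ys: "ys \<in> tuples A (rel_dom \<Sigma> r)"
      and "Inl ` set (zip (rel_dom \<Sigma> r) ys) \<subseteq> D" and holds: "rint A r ys"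
    then have ps: "set (zip (rel_dom \<Sigma> r) ys) \<subseteq> E" by (auto simp: E_def)
    let ?\<phi> = "Rel r (map (Var \<circ> v) (zip (rel_dom \<Sigma> r) ys))"
    have "?\<phi> \<in> X_rel" unfolding X_rel_def
      using r ps tuple(3)[OF ys] by (intro image_eqI[of _ _ "(r, zip (rel_dom \<Sigma> r) ys)"]) auto
    moreover have "r \<in> rels \<Sigma>" using r D(2) by (auto simp: ingredients_def)
    then have "is_fm \<Sigma> ?\<phi>"
      using v_sorts[OF ps] map_sorts(1)[OF ps] tuple(1)[OF ys] by simp
    moreover have "sat A e ?\<phi>" using map_sorts(2)[OF ps] tuple(2)[OF ys] holds by simp
    ultimately have "sat C e' ?\<phi>" by (intro sat_\<Phi>) (simp add: \<Phi>_def del: is_fm.simps)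
    moreover have "val C e' \<circ> (Var \<circ> v) = e' \<circ> v" by auto
    ultimately show "rint C r (map2 g (rel_dom \<Sigma> r) ys)" by (simp add: map2_g)
  qed
  moreover have "g (snd x) (snd (inv_into E v x)) = e' x" if x: "x \<in> free_vars \<psi>" for x
  proof -
    obtain p where p: "p \<in> E" "x = v p" using \<psi>(3) x by blast
    then show ?thesis using v by (simp add: g_def)
  qed
  then have "\<not> sat C (\<lambda>x. g (snd x) (snd (inv_into E v x))) \<psi>"
    using nsat sat_cong[of \<psi> "\<lambda>x. g (snd x) (snd (inv_into E v x))" e' C] by blast
  ultimately show thesis by (rule that)
qed

lemma sorted_variables:
  assumes "finite (E :: ('u \<times> 'a) set)"
  obtains v :: "'u \<times> 'a \<Rightarrow> nat \<times> 'u" where "inj_on v E" "\<And>p. p \<in> E \<Longrightarrow> snd (v p) = fst p"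
proof -
  obtain k :: "'u \<times> 'a \<Rightarrow> nat" where "inj_on k E"
    using finite_imp_inj_to_nat_seg[OF assms] by blast
  then have "inj_on (\<lambda>p. (k p, fst p)) E" by (auto simp: inj_on_def)
  then show thesis by (intro that) auto
qed

lemma local_hom_distinguishes:
  assumes horn: "\<forall>\<chi>\<in>horn_theory \<Sigma> C. holds A \<chi>"
    and D: "finite D" "D \<subseteq> ingredients \<Sigma> A" and ab: "Inl (s, a) \<in> D" "Inl (s, b) \<in> D" "a \<noteq> b"
  shows "\<exists>g. local_hom \<Sigma> A C D g \<and> g s a \<noteq> g s b"
proof -
  define E where "E = {p. Inl p \<in> D}"
  have "finite E" unfolding E_def using D(1) finite_vimageI[of D Inl] by (simp add: vimage_def)
  then obtain v :: "_ \<Rightarrow> nat \<times> 'a" where v: "inj_on v E" "\<And>p. p \<in> E \<Longrightarrow> snd (v p) = fst p" using sorted_variables by blast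
  have E: "(s, a) \<in> E" "(s, b) \<in> E" "s \<in> sorts \<Sigma>"
    using ab D(2) by (auto simp: E_def ingredients_def)
  let ?\<psi> = "Eq (Var (v (s, a))) (Var (v (s, b)))"
  have nsat: "\<not> sat A (\<lambda>x. snd (inv_into E v x)) ?\<psi>" using E v(1) ab(3) by simp
  obtain g where g: "local_hom \<Sigma> A C D g" "\<not> sat C (\<lambda>x. g (snd x) (snd (inv_into E v x))) ?\<psi>"
    by (rule horn_theory_local_hom[OF horn D E_def v _ _ _ nsat]) (use E v in \<open>simp_all add: atomic_def\<close>)
  show ?thesis using g v(1) E v(2)[OF E(1)] v(2)[OF E(2)] by auto
qed

lemma local_hom_refutes:
  assumes sig: "is_signature \<Sigma>" and horn: "\<forall>\<chi>\<in>horn_theory \<Sigma> C. holds A \<chi>"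
    and D: "finite D" "D \<subseteq> ingredients \<Sigma> A"
    and r: "r \<in> rels \<Sigma>" and xs: "xs \<in> tuples A (rel_dom \<Sigma> r)" "Inl ` set (zip (rel_dom \<Sigma> r) xs) \<subseteq> D"
    and neg: "\<not> rint A r xs"
  shows "\<exists>g. local_hom \<Sigma> A C D g \<and> \<not> rint C r (map2 g (rel_dom \<Sigma> r) xs)"
proof -
  define E where "E = {p. Inl p \<in> D}"
  have "finite E" unfolding E_def using D(1) finite_vimageI[of D Inl] by (simp add: vimage_def)
  then obtain v :: "_ \<Rightarrow> nat \<times> 'a" where v: "inj_on v E" "\<And>p. p \<in> E \<Longrightarrow> snd (v p) = fst p" using sorted_variables by blast
  let ?ps = "zip (rel_dom \<Sigma> r) xs"
  have ps: "set ?ps \<subseteq> E" using xs(2) by (auto simp: E_def)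
  have len: "length xs = length (rel_dom \<Sigma> r)" using xs(1) by (auto simp: tuples_def dest: list_all2_lengthD)
  have inv: "inv_into E v (v p) = p" "snd (v p) = fst p" if "p \<in> set ?ps" for p
    using subsetD[OF ps that] v by simp_all
  have sorts: "fst p \<in> sorts \<Sigma>" if "p \<in> set ?ps" for p
    using set_zip_leftD[of "fst p" "snd p" "rel_dom \<Sigma> r" xs] that signature_sorts(3)[OF sig r] by auto
  let ?\<psi> = "Rel r (map (Var \<circ> v) ?ps)"
  have A_vals: "map (val A (\<lambda>x. snd (inv_into E v x)) \<circ> (Var \<circ> v)) ?ps = map snd ?ps" using inv(1) by auto
  have C_vals: "map (val C (\<lambda>x. g (snd x) (snd (inv_into E v x))) \<circ> (Var \<circ> v)) ?ps
      = map2 g (rel_dom \<Sigma> r) xs" for g using inv by auto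
  have fm: "is_fm \<Sigma> ?\<psi>"
  proof -
    have "map (sort_of \<Sigma> \<circ> (Var \<circ> v)) ?ps = map fst ?ps" using inv(2) by auto
    then show ?thesis using r len inv(2) sorts by auto
  qed
  have vars: "free_vars ?\<psi> \<subseteq> v ` E" using ps by auto
  have nsat: "\<not> sat A (\<lambda>x. snd (inv_into E v x)) ?\<psi>" using neg A_vals len by simp
  obtain g where g: "local_hom \<Sigma> A C D g" "\<not> sat C (\<lambda>x. g (snd x) (snd (inv_into E v x))) ?\<psi>"
    by (rule horn_theory_local_hom[OF horn D E_def v _ fm vars nsat]) (simp_all add: atomic_def)
  show ?thesis using g(1) g(2)[unfolded sat.simps map_map C_vals] by blast
qed

section \<open>Ultrapowers\<close>

definition ultrafilter :: "'i filter \<Rightarrow> bool" where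
  "ultrafilter U \<longleftrightarrow> U \<noteq> bot \<and> (\<forall>P. eventually P U \<or> eventually (\<lambda>i. \<not> P i) U)"

lemma ultrafilter_not:
  assumes "ultrafilter U" shows "eventually (\<lambda>i. \<not> P i) U \<longleftrightarrow> \<not> eventually P U"
proof
  assume "eventually (\<lambda>i. \<not> P i) U"
  show "\<not> eventually P U"
  proof
    assume "eventually P U"
    with \<open>eventually (\<lambda>i. \<not> P i) U\<close> have "eventually (\<lambda>i. False) U" by eventually_elim simp
    then show False using assms by (simp add: ultrafilter_def eventually_False)
  qed
qed (use assms in \<open>auto simp: ultrafilter_def\<close>)

lemma ultrafilter_const:
  assumes "ultrafilter U" shows "eventually (\<lambda>i. Q) U \<longleftrightarrow> Q"
  using assms by (cases Q) (auto simp: ultrafilter_def eventually_False)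

lemma ultrafilter_imp:
  assumes "ultrafilter U"
  shows "eventually (\<lambda>i. P i \<longrightarrow> Q i) U \<longleftrightarrow> (eventually P U \<longrightarrow> eventually Q U)"
proof
  assume *: "eventually (\<lambda>i. P i \<longrightarrow> Q i) U"
  show "eventually P U \<longrightarrow> eventually Q U"
  proof
    assume "eventually P U"
    with * show "eventually Q U" by eventually_elim simp
  qed
next
  assume "eventually P U \<longrightarrow> eventually Q U"
  then consider "eventually (\<lambda>i. \<not> P i) U" | "eventually Q U" using ultrafilter_not[OF assms] by blast
  then show "eventually (\<lambda>i. P i \<longrightarrow> Q i) U"
  proof cases
    case 1 then show ?thesis by eventually_elim simp
  next
    case 2 then show ?thesis by eventually_elim simp
  qed
qed

text \<open>
  By Zorn's lemma for the reversed order there is a minimal proper filter below \<open>F\<close>. Restricting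
  it to a predicate that it does not refute leaves it unchanged, so it decides every predicate.
\<close>

lemma ultrafilter_exists:
  fixes F :: "'i filter"
  assumes "F \<noteq> bot"
  obtains U where "ultrafilter U" "U \<le> F"
proof -
  let ?A = "{G. G \<noteq> bot \<and> G \<le> F}"
  have "\<exists>U\<in>?A. \<forall>G\<in>?A. G \<le> U \<longrightarrow> G = U"
  proof (rule predicate_Zorn[of ?A "\<lambda>x y. y \<le> x"])
    show "partial_order_on ?A (relation_of (\<lambda>x y. y \<le> x) ?A)"
      by (rule partial_order_on_relation_ofI) auto
    fix B assume "B \<in> Chains (relation_of (\<lambda>x y. y \<le> x) ?A)"
    then have B: "B \<subseteq> ?A" "\<And>G H. G \<in> B \<Longrightarrow> H \<in> B \<Longrightarrow> G \<le> H \<or> H \<le> G"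
      unfolding Chains_def relation_of_def by auto
    show "\<exists>L\<in>?A. \<forall>G\<in>B. L \<le> G"
    proof (cases "B = {}")
      case True
      then show ?thesis using assms by auto
    next
      case False
      have "eventually (\<lambda>i. False) (Inf B) \<longleftrightarrow> (\<exists>G\<in>B. eventually (\<lambda>i. False) G)"
        by (rule eventually_Inf_base[OF False]) (metis B(2) inf.absorb_iff1 inf.absorb_iff2 order_refl)
      then have "Inf B \<noteq> bot" using B(1) by (auto simp: eventually_False)
      moreover have "Inf B \<le> F" using False B(1) by (blast intro: Inf_lower2)
      ultimately show ?thesis by (intro bexI[of _ "Inf B"]) (auto intro: Inf_lower)
    qed
  qed
  then obtain U where U: "U \<noteq> bot" "U \<le> F" and min: "\<And>G. G \<noteq> bot \<Longrightarrow> G \<le> F \<Longrightarrow> G \<le> U \<Longrightarrow> G = U"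
    by blast
  have "eventually P U \<or> eventually (\<lambda>i. \<not> P i) U" for P
  proof (rule disjCI)
    assume nP: "\<not> eventually (\<lambda>i. \<not> P i) U"
    let ?G = "inf U (principal {i. P i})"
    have "?G \<noteq> bot"
      using nP by (auto simp: eventually_False[symmetric] eventually_inf_principal)
    moreover have "?G \<le> U" "?G \<le> F" using U(2) by (auto intro: le_infI1)
    ultimately have "?G = U" using min by blast
    moreover have "eventually P ?G" by (simp add: eventually_inf_principal)
    ultimately show "eventually P U" by simp
  qed
  then show thesis using U by (intro that[of U]) (auto simp: ultrafilter_def)
qed

text \<open>
  An ultrapower of \<open>M\<close> whose elements are codes: \<open>c s\<close> sends a family of elements of sort \<open>s\<close>
  to the code of its class, so that the codes may be chosen in the universe.

  All factors are the same structure because carriers may be empty. Quantifiers over the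
  ultrapower range over total families, and a family picking witnesses on a set of indices in the
  ultrafilter extends to a total one only if the remaining factors have elements of that sort.
\<close>

locale ultrapower =
  fixes \<Sigma> :: "'u signature" and M :: "('u, 'a) struct" and I :: "'i set" and U :: "'i filter"
    and c :: "'u \<Rightarrow> ('i \<Rightarrow> 'a) \<Rightarrow> 'b"
  assumes sig: "is_signature \<Sigma>" and M: "is_struct \<Sigma> M"
    and ultra: "ultrafilter U" and in_I: "eventually (\<lambda>i. i \<in> I) U"
    and code_eq: "\<And>s x y. s \<in> sorts \<Sigma> \<Longrightarrow> x \<in> I \<rightarrow> carr M s \<Longrightarrow> y \<in> I \<rightarrow> carr M s \<Longrightarrow>
      c s x = c s y \<longleftrightarrow> eventually (\<lambda>i. x i = y i) U"
begin

definition decode :: "'u \<Rightarrow> 'b \<Rightarrow> 'i \<Rightarrow> 'a" where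
  "decode s = inv_into (I \<rightarrow> carr M s) (c s)"

definition power :: "('u, 'b) struct" where
  "power = \<lparr>
     carr = (\<lambda>s. c s ` (I \<rightarrow> carr M s)),
     fint = (\<lambda>f zs. c (fun_cod \<Sigma> f) (\<lambda>i. fint M f (map2 (\<lambda>s z. decode s z i) (fun_dom \<Sigma> f) zs))),
     rint = (\<lambda>r zs. eventually (\<lambda>i. rint M r (map2 (\<lambda>s z. decode s z i) (rel_dom \<Sigma> r) zs)) U) \<rparr>"

lemma decode_carr: "z \<in> carr power s \<Longrightarrow> decode s z \<in> I \<rightarrow> carr M s"
  unfolding power_def decode_def by (simp add: inv_into_into)

lemma decode_code:
  assumes "s \<in> sorts \<Sigma>" "x \<in> I \<rightarrow> carr M s"
  shows "eventually (\<lambda>i. decode s (c s x) i = x i) U"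
proof -
  have "c s (decode s (c s x)) = c s x" 
    unfolding decode_def using assms(2) by (simp add: f_inv_into_f[OF imageI])
  moreover have "decode s (c s x) \<in> I \<rightarrow> carr M s" using assms(2) by (intro decode_carr) (simp add: power_def)
  ultimately show ?thesis using code_eq[OF assms(1)] assms(2) by blast
qed

lemma decode_codes:
  assumes "list_all2 (\<lambda>x s. x \<in> I \<rightarrow> carr M s) xs ss" "set ss \<subseteq> sorts \<Sigma>"
  shows "eventually (\<lambda>i. map2 (\<lambda>s z. decode s z i) ss (map2 c ss xs) = map (\<lambda>x. x i) xs) U"
  using assms
proof (induction rule: list_all2_induct)
  case (Cons x xs s ss)
  then have "eventually (\<lambda>i. map2 (\<lambda>s z. decode s z i) ss (map2 c ss xs) = map (\<lambda>x. x i) xs) U" by simp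
  moreover have "eventually (\<lambda>i. decode s (c s x) i = x i) U" using Cons by (intro decode_code) auto
  ultimately show ?case by eventually_elim simp
qed simp

lemma family_tuples:
  assumes "list_all2 (\<lambda>x s. x \<in> I \<rightarrow> carr M s) xs ss" "i \<in> I"
  shows "map (\<lambda>x. x i) xs \<in> tuples M ss"
  using assms unfolding tuples_def by (induction rule: list_all2_induct) auto

lemma fint_family:
  assumes "f \<in> funs \<Sigma>" "list_all2 (\<lambda>x s. x \<in> I \<rightarrow> carr M s) xs (fun_dom \<Sigma> f)"
  shows "(\<lambda>i. fint M f (map (\<lambda>x. x i) xs)) \<in> I \<rightarrow> carr M (fun_cod \<Sigma> f)"
  using M assms family_tuples unfolding is_struct_def by blast

lemma decode_family:
  assumes "zs \<in> tuples power ss" "i \<in> I"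
  shows "map2 (\<lambda>s z. decode s z i) ss zs \<in> tuples M ss"
  using decode_carr assms(2) by (intro tuples_map2[OF assms(1)]) blast

lemma decode_fint_family:
  assumes "f \<in> funs \<Sigma>" "zs \<in> tuples power (fun_dom \<Sigma> f)"
  shows "(\<lambda>i. fint M f (map2 (\<lambda>s z. decode s z i) (fun_dom \<Sigma> f) zs)) \<in> I \<rightarrow> carr M (fun_cod \<Sigma> f)"
  using M assms decode_family unfolding is_struct_def by blast

lemma is_struct_power: "is_struct \<Sigma> power"
  unfolding is_struct_def using decode_fint_family by (simp add: power_def)

lemma codes_tuples:
  assumes "list_all2 (\<lambda>x s. x \<in> I \<rightarrow> carr M s) xs ss"
  shows "map2 c ss xs \<in> tuples power ss"
  using assms unfolding tuples_def by (induction rule: list_all2_induct) (auto simp: power_def)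

lemma fint_codes:
  assumes f: "f \<in> funs \<Sigma>" and xs: "list_all2 (\<lambda>x s. x \<in> I \<rightarrow> carr M s) xs (fun_dom \<Sigma> f)"
  shows "fint power f (map2 c (fun_dom \<Sigma> f) xs) = c (fun_cod \<Sigma> f) (\<lambda>i. fint M f (map (\<lambda>x. x i) xs))"
proof -
  note ss = signature_sorts(1,2)[OF sig f]
  have "eventually (\<lambda>i. fint M f (map2 (\<lambda>s z. decode s z i) (fun_dom \<Sigma> f) (map2 c (fun_dom \<Sigma> f) xs))
      = fint M f (map (\<lambda>x. x i) xs)) U"
    using decode_codes[OF xs ss(1)] by eventually_elim simp
  then show ?thesis
    using code_eq[OF ss(2) decode_fint_family[OF f codes_tuples[OF xs]] fint_family[OF f xs]]
    by (simp add: power_def)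
qed

lemma rint_codes:
  assumes r: "r \<in> rels \<Sigma>" and xs: "list_all2 (\<lambda>x s. x \<in> I \<rightarrow> carr M s) xs (rel_dom \<Sigma> r)"
  shows "rint power r (map2 c (rel_dom \<Sigma> r) xs) \<longleftrightarrow> eventually (\<lambda>i. rint M r (map (\<lambda>x. x i) xs)) U"
  unfolding power_def struct.select_convs
  by (rule eventually_cong[OF decode_codes[OF xs signature_sorts(3)[OF sig r]]]) simp

lemma vals_families:
  assumes "\<And>t. t \<in> set ts \<Longrightarrow> is_trm \<Sigma> t"
    and E: "\<And>t x. t \<in> set ts \<Longrightarrow> x \<in> trm_vars t \<Longrightarrow> E x \<in> I \<rightarrow> carr M (snd x)"
  shows "list_all2 (\<lambda>x s. x \<in> I \<rightarrow> carr M s) (map (\<lambda>t i. val M (\<lambda>x. E x i) t) ts) (map (sort_of \<Sigma>) ts)"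
proof -
  have "val M (\<lambda>x. E x i) t \<in> carr M (sort_of \<Sigma> t)" if "t \<in> set ts" "i \<in> I" for t i
    using E[OF that(1)] that by (intro val_carr[OF M] assms(1)) blast+
  then show ?thesis by (simp add: list.rel_map list_all2_same)
qed

lemma val_power:
  "is_trm \<Sigma> t \<Longrightarrow> (\<And>x. x \<in> trm_vars t \<Longrightarrow> E x \<in> I \<rightarrow> carr M (snd x)) \<Longrightarrow>
   (\<And>x. x \<in> trm_vars t \<Longrightarrow> e x = c (snd x) (E x)) \<Longrightarrow>
   val power e t = c (sort_of \<Sigma> t) (\<lambda>i. val M (\<lambda>x. E x i) t)"
proof (induction t)
  case (App f ts)
  let ?xs = "map (\<lambda>t i. val M (\<lambda>x. E x i) t) ts"
  have "list_all2 (\<lambda>x s. x \<in> I \<rightarrow> carr M s) ?xs (map (sort_of \<Sigma>) ts)"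
    using App.prems by (intro vals_families) auto
  then have xs: "list_all2 (\<lambda>x s. x \<in> I \<rightarrow> carr M s) ?xs (fun_dom \<Sigma> f)"
    using App.prems(1) by simp
  have "val power e t = c (sort_of \<Sigma> t) (\<lambda>i. val M (\<lambda>x. E x i) t)" if "t \<in> set ts" for t
    using App.prems(1) that by (intro App.IH App.prems(2,3)) auto
  then have "map (val power e) ts = map2 c (map (sort_of \<Sigma>) ts) ?xs"
    unfolding map2_map_sort_of by simp
  then have "map (val power e) ts = map2 c (fun_dom \<Sigma> f) ?xs" using App.prems(1) by simp
  moreover have "f \<in> funs \<Sigma>" using App.prems(1) by simp
  ultimately show ?case
    using fint_codes[OF _ xs] by (simp add: comp_def)
qed simp

text \<open>
  The theorem of Los. The connectives are properties of ultrafilters; for the quantifier,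
  counterexamples in the single factors are collected into one family, that is, one element.
\<close>

theorem sat_power:
  "is_fm \<Sigma> \<phi> \<Longrightarrow> (\<And>x. x \<in> free_vars \<phi> \<Longrightarrow> E x \<in> I \<rightarrow> carr M (snd x)) \<Longrightarrow>
   (\<And>x. x \<in> free_vars \<phi> \<Longrightarrow> e x = c (snd x) (E x)) \<Longrightarrow>
   sat power e \<phi> \<longleftrightarrow> eventually (\<lambda>i. sat M (\<lambda>x. E x i) \<phi>) U"
proof (induction \<phi> arbitrary: e E)
  case (Eq t u)
  have *: "(\<lambda>i. val M (\<lambda>x. E x i) v) \<in> I \<rightarrow> carr M (sort_of \<Sigma> v)" "sort_of \<Sigma> v \<in> sorts \<Sigma>"
    if "v = t \<or> v = u" for v
  proof -
    have v: "is_trm \<Sigma> v" "\<And>x. x \<in> trm_vars v \<Longrightarrow> E x \<in> I \<rightarrow> carr M (snd x)" using Eq.prems that by auto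
    show "(\<lambda>i. val M (\<lambda>x. E x i) v) \<in> I \<rightarrow> carr M (sort_of \<Sigma> v)"
      using vals_families[of "[v]" E] v by simp
    show "sort_of \<Sigma> v \<in> sorts \<Sigma>" using v(1) signature_sorts(2)[OF sig] by (cases v) auto
  qed
  have "val power e v = c (sort_of \<Sigma> v) (\<lambda>i. val M (\<lambda>x. E x i) v)" if "v = t \<or> v = u" for v
    using Eq.prems(1) that by (intro val_power Eq.prems(2,3)) auto
  moreover have "sort_of \<Sigma> t = sort_of \<Sigma> u" using Eq.prems(1) by simp
  moreover from this have "c (sort_of \<Sigma> t) (\<lambda>i. val M (\<lambda>x. E x i) t) = c (sort_of \<Sigma> t) (\<lambda>i. val M (\<lambda>x. E x i) u)
      \<longleftrightarrow> eventually (\<lambda>i. val M (\<lambda>x. E x i) t = val M (\<lambda>x. E x i) u) U"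
    using *[of t] *[of u] by (intro code_eq) simp_all
  ultimately show ?case by simp
next
  case (Rel r ts)
  let ?xs = "map (\<lambda>t i. val M (\<lambda>x. E x i) t) ts"
  have "list_all2 (\<lambda>x s. x \<in> I \<rightarrow> carr M s) ?xs (map (sort_of \<Sigma>) ts)"
    using Rel.prems by (intro vals_families) auto
  then have xs: "list_all2 (\<lambda>x s. x \<in> I \<rightarrow> carr M s) ?xs (rel_dom \<Sigma> r)"
    using Rel.prems(1) by simp
  have "val power e t = c (sort_of \<Sigma> t) (\<lambda>i. val M (\<lambda>x. E x i) t)" if "t \<in> set ts" for t
    using Rel.prems(1) that by (intro val_power Rel.prems(2,3)) auto
  then have "map (val power e) ts = map2 c (map (sort_of \<Sigma>) ts) ?xs"
    unfolding map2_map_sort_of by simp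
  then have "map (val power e) ts = map2 c (rel_dom \<Sigma> r) ?xs" using Rel.prems(1) by simp
  moreover have "r \<in> rels \<Sigma>" using Rel.prems(1) by simp
  ultimately show ?case
    using rint_codes[OF _ xs] by (simp add: comp_def)
next
  case Falsum
  then show ?case using ultrafilter_const[OF ultra, of False] by simp
next
  case (Conj \<phi> \<psi>)
  have "sat power e \<phi> \<longleftrightarrow> eventually (\<lambda>i. sat M (\<lambda>x. E x i) \<phi>) U"
    using Conj.prems by (intro Conj.IH(1)) auto
  moreover have "sat power e \<psi> \<longleftrightarrow> eventually (\<lambda>i. sat M (\<lambda>x. E x i) \<psi>) U"
    using Conj.prems by (intro Conj.IH(2)) auto
  ultimately show ?case by (simp add: eventually_conj_iff)
next
  case (Imp \<phi> \<psi>)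
  have "sat power e \<phi> \<longleftrightarrow> eventually (\<lambda>i. sat M (\<lambda>x. E x i) \<phi>) U"
    using Imp.prems by (intro Imp.IH(1)) auto
  moreover have "sat power e \<psi> \<longleftrightarrow> eventually (\<lambda>i. sat M (\<lambda>x. E x i) \<psi>) U"
    using Imp.prems by (intro Imp.IH(2)) auto
  ultimately show ?case by (simp add: ultrafilter_imp[OF ultra])
next
  case (All x \<phi>)
  let ?Q = "\<lambda>i a. sat M ((\<lambda>y. E y i)(x := a)) \<phi>"
  have upd: "(\<lambda>y. (E(x := X)) y i) = (\<lambda>y. E y i)(x := X i)" for X :: "'i \<Rightarrow> 'a" and i by auto
  have inst: "sat power (e(x := c (snd x) X)) \<phi> \<longleftrightarrow> eventually (\<lambda>i. ?Q i (X i)) U"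
    if X: "X \<in> I \<rightarrow> carr M (snd x)" for X
  proof -
    have "sat power (e(x := c (snd x) X)) \<phi> \<longleftrightarrow> eventually (\<lambda>i. sat M (\<lambda>y. (E(x := X)) y i) \<phi>) U"
      using All.prems X by (intro All.IH) auto
    then show ?thesis by (simp only: upd)
  qed
  have "sat power e (All x \<phi>) \<longleftrightarrow> (\<forall>X\<in>I \<rightarrow> carr M (snd x). eventually (\<lambda>i. ?Q i (X i)) U)"
    using inst by (simp add: power_def)
  also have "\<dots> \<longleftrightarrow> eventually (\<lambda>i. \<forall>a\<in>carr M (snd x). ?Q i a) U"
  proof
    assume *: "eventually (\<lambda>i. \<forall>a\<in>carr M (snd x). ?Q i a) U"
    show "\<forall>X\<in>I \<rightarrow> carr M (snd x). eventually (\<lambda>i. ?Q i (X i)) U"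
    proof
      fix X assume X: "X \<in> I \<rightarrow> carr M (snd x)"
      show "eventually (\<lambda>i. ?Q i (X i)) U" using * in_I by eventually_elim (use X in blast)
    qed
  next
    assume *: "\<forall>X\<in>I \<rightarrow> carr M (snd x). eventually (\<lambda>i. ?Q i (X i)) U"
    show "eventually (\<lambda>i. \<forall>a\<in>carr M (snd x). ?Q i a) U"
    proof (cases "carr M (snd x) = {}")
      case False
      \<comment> \<open>A family of counterexamples wherever there are any.\<close>
      define X where "X i = (if \<exists>a\<in>carr M (snd x). \<not> ?Q i a then SOME a. a \<in> carr M (snd x) \<and> \<not> ?Q i a
        else SOME a. a \<in> carr M (snd x))" for i
      have X: "X i \<in> carr M (snd x) \<and> (?Q i (X i) \<longrightarrow> (\<forall>a\<in>carr M (snd x). ?Q i a))" for i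
      proof (cases "\<exists>a\<in>carr M (snd x). \<not> ?Q i a")
        case True
        then have "\<exists>a. a \<in> carr M (snd x) \<and> \<not> ?Q i a" by blast
        from someI_ex[OF this] show ?thesis using True by (simp add: X_def)
      next
        case no_counterexample: False
        then have "X i = (SOME a. a \<in> carr M (snd x))" unfolding X_def by (rule if_not_P)
        then show ?thesis using no_counterexample some_in_eq[of "carr M (snd x)"] False by simp
      qed
      then have "eventually (\<lambda>i. ?Q i (X i)) U" using * by blast
      then show ?thesis by eventually_elim (use X in blast)
    qed simp
  qed
  finally show ?case by simp
qed

corollary holds_power:
  assumes "\<phi> \<in> sentences \<Sigma>" "holds M \<phi>"
  shows "holds power \<phi>"
proof -
  have "sat power e \<phi> \<longleftrightarrow> eventually (\<lambda>i. sat M (\<lambda>x. undefined) \<phi>) U" for e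
    using assms(1) by (intro sat_power) (auto simp: sentences_def)
  then show ?thesis using assms(2) by (simp add: holds_def)
qed

context
  fixes \<Sigma>0 :: "'u signature" and A :: "('u, 'd) struct" and X :: "'u \<Rightarrow> 'd \<Rightarrow> 'i \<Rightarrow> 'a"
  assumes sig0: "is_signature \<Sigma>0" and sub: "subsignature \<Sigma>0 \<Sigma>"
    and X: "\<And>s a. s \<in> sorts \<Sigma>0 \<Longrightarrow> a \<in> carr A s \<Longrightarrow> X s a \<in> I \<rightarrow> carr M s"
begin

lemma families_tuples:
  assumes "ys \<in> tuples A ss" "set ss \<subseteq> sorts \<Sigma>0"
  shows "list_all2 (\<lambda>x s. x \<in> I \<rightarrow> carr M s) (map2 X ss ys) ss"
proof -
  have "list_all2 (\<lambda>y s. y \<in> carr A s) ys ss" using assms(1) by (simp add: tuples_def)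
  then show ?thesis using assms(2) X by (induction rule: list_all2_induct) auto
qed

lemma map_map2_families: "map (\<lambda>x. x i) (map2 X ss ys) = map2 (\<lambda>s a. X s a i) ss ys"
  by auto

lemma induced_rint:
  assumes r: "r \<in> rels \<Sigma>0" and ys: "ys \<in> tuples A (rel_dom \<Sigma>0 r)"
  shows "rint power r (map2 (\<lambda>s a. c s (X s a)) (rel_dom \<Sigma>0 r) ys) \<longleftrightarrow>
    eventually (\<lambda>i. rint M r (map2 (\<lambda>s a. X s a i) (rel_dom \<Sigma>0 r) ys)) U"
proof -
  have "r \<in> rels \<Sigma>" "rel_dom \<Sigma> r = rel_dom \<Sigma>0 r" using r sub by (auto simp: subsignature_def)
  then show ?thesis
    using rint_codes[of r "map2 X (rel_dom \<Sigma>0 r) ys"] families_tuples[OF ys signature_sorts(3)[OF sig0 r]]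
    by (simp add: map_map2_families map2_map2 del: map_map)
qed

text \<open>
  No member of the family need be a homomorphism: each single instance of the conditions is only
  asked of almost all members, and the exceptions may depend on the instance.
\<close>

lemma induced_hom:
  assumes A: "is_struct \<Sigma>0 A"
    and fun_ae: "\<And>f ys. f \<in> funs \<Sigma>0 \<Longrightarrow> ys \<in> tuples A (fun_dom \<Sigma>0 f) \<Longrightarrow>
      eventually (\<lambda>i. X (fun_cod \<Sigma>0 f) (fint A f ys) i = fint M f (map2 (\<lambda>s a. X s a i) (fun_dom \<Sigma>0 f) ys)) U"
    and rel_ae: "\<And>r ys. r \<in> rels \<Sigma>0 \<Longrightarrow> ys \<in> tuples A (rel_dom \<Sigma>0 r) \<Longrightarrow> rint A r ys \<Longrightarrow>
      eventually (\<lambda>i. rint M r (map2 (\<lambda>s a. X s a i) (rel_dom \<Sigma>0 r) ys)) U"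
  shows "hom_family \<Sigma>0 A (\<lambda>s a. c s (X s a)) \<in> Hom \<Sigma>0 A power"
proof (rule hom_family_in_Hom[OF sig0 A])
  show "c s (X s a) \<in> carr power s" if "s \<in> sorts \<Sigma>0" "a \<in> carr A s" for s a
    using X[OF that] by (auto simp: power_def)
  show "c (fun_cod \<Sigma>0 f) (X (fun_cod \<Sigma>0 f) (fint A f ys))
      = fint power f (map2 (\<lambda>s a. c s (X s a)) (fun_dom \<Sigma>0 f) ys)"
    if f: "f \<in> funs \<Sigma>0" and ys: "ys \<in> tuples A (fun_dom \<Sigma>0 f)" for f ys
  proof -
    have f': "f \<in> funs \<Sigma>" and dom: "fun_dom \<Sigma> f = fun_dom \<Sigma>0 f" "fun_cod \<Sigma> f = fun_cod \<Sigma>0 f"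
      using f sub by (auto simp: subsignature_def)
    have cod: "fun_cod \<Sigma>0 f \<in> sorts \<Sigma>0" "fun_cod \<Sigma>0 f \<in> sorts \<Sigma>"
      using signature_sorts(2)[OF sig0 f] sub by (auto simp: subsignature_def)
    note xs = families_tuples[OF ys signature_sorts(1)[OF sig0 f], folded dom(1)]
    have "fint A f ys \<in> carr A (fun_cod \<Sigma>0 f)" using A f ys by (auto simp: is_struct_def)
    note X_val = X[OF cod(1) this]
    have "c (fun_cod \<Sigma>0 f) (X (fun_cod \<Sigma>0 f) (fint A f ys))
        = c (fun_cod \<Sigma>0 f) (\<lambda>i. fint M f (map (\<lambda>x. x i) (map2 X (fun_dom \<Sigma>0 f) ys)))"
      unfolding code_eq[OF cod(2) X_val fint_family[OF f' xs, unfolded dom]]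
      using fun_ae[OF f ys] by (simp only: map_map2_families)
    also have "\<dots> = fint power f (map2 c (fun_dom \<Sigma>0 f) (map2 X (fun_dom \<Sigma>0 f) ys))"
      using fint_codes[OF f' xs] by (simp only: dom)
    finally show ?thesis unfolding map2_map2 .
  qed
qed (use rel_ae induced_rint in auto)

end

end

text \<open>
  The codes exist in the universe because the classes of families are sets of families, and a power
  of a small set by a small set is small.
\<close>

lemma ultrapower_codes:
  assumes univ: "set_universe TYPE('u)" and I: "I \<prec> (UNIV :: 'u set)"
    and M: "\<And>s. s \<in> S \<Longrightarrow> carr M s \<prec> (UNIV :: 'u set)"
    and in_I: "eventually (\<lambda>i. i \<in> I) U"
  obtains c :: "'s \<Rightarrow> ('i \<Rightarrow> 'a) \<Rightarrow> 'u" where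
    "\<And>s x y. s \<in> S \<Longrightarrow> x \<in> I \<rightarrow> carr M s \<Longrightarrow> y \<in> I \<rightarrow> carr M s \<Longrightarrow>
      c s x = c s y \<longleftrightarrow> eventually (\<lambda>i. x i = y i) U"
    "\<And>s. s \<in> S \<Longrightarrow> small (c s ` (I \<rightarrow> carr M s))"
proof -
  define cls where "cls s x = {y \<in> I \<rightarrow>\<^sub>E carr M s. eventually (\<lambda>i. x i = y i) U}" for s x
  have cls: "cls s x = cls s y \<longleftrightarrow> eventually (\<lambda>i. x i = y i) U" if x: "x \<in> I \<rightarrow> carr M s" for s x y
  proof
    assume eq: "cls s x = cls s y"
    have "eventually (\<lambda>i. x i = restrict x I i) U" using in_I by eventually_elim simp
    moreover from this have "restrict x I \<in> cls s x" using x by (simp add: cls_def)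
    then have "restrict x I \<in> cls s y" unfolding eq .
    then have "eventually (\<lambda>i. y i = restrict x I i) U" by (simp add: cls_def)
    ultimately show "eventually (\<lambda>i. x i = y i) U" by eventually_elim simp
  next
    assume eq: "eventually (\<lambda>i. x i = y i) U"
    have "eventually (\<lambda>i. x i = z i) U \<longleftrightarrow> eventually (\<lambda>i. y i = z i) U" for z
      using eq by (rule eventually_cong) simp
    then show "cls s x = cls s y" by (simp add: cls_def)
  qed
  have "\<exists>k :: ('i \<Rightarrow> 'a) set \<Rightarrow> 'u. inj_on k (cls s ` (I \<rightarrow> carr M s)) \<and> small (k ` cls s ` (I \<rightarrow> carr M s))"
    if s: "s \<in> S" for s
  proof -
    have "cls s ` (I \<rightarrow> carr M s) \<subseteq> Pow (I \<rightarrow>\<^sub>E carr M s)" by (auto simp: cls_def)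
    then have "cls s ` (I \<rightarrow> carr M s) \<lesssim> Pow (I \<rightarrow>\<^sub>E carr M s)" by (rule subset_imp_lepoll)
    also have "\<dots> \<prec> (UNIV :: 'u set)"
      using M[OF s] by (intro lesspoll_UNIV_Pow lesspoll_UNIV_PiE univ I)
    finally show ?thesis using lesspoll_UNIV_code by metis
  qed
  then obtain k :: "'s \<Rightarrow> ('i \<Rightarrow> 'a) set \<Rightarrow> 'u" where
    k: "\<And>s. s \<in> S \<Longrightarrow> inj_on (k s) (cls s ` (I \<rightarrow> carr M s))"
       "\<And>s. s \<in> S \<Longrightarrow> small (k s ` cls s ` (I \<rightarrow> carr M s))" by metis
  show thesis
  proof (rule that[of "\<lambda>s x. k s (cls s x)"])
    show "k s (cls s x) = k s (cls s y) \<longleftrightarrow> eventually (\<lambda>i. x i = y i) U"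
      if "s \<in> S" "x \<in> I \<rightarrow> carr M s" "y \<in> I \<rightarrow> carr M s" for s x y
      using inj_on_eq_iff[OF k(1)[OF that(1)] imageI[OF that(2)] imageI[OF that(3)]] cls[OF that(2)] by simp
    show "small ((\<lambda>x. k s (cls s x)) ` (I \<rightarrow> carr M s))" if "s \<in> S" for s
      using k(2)[OF that] by (simp add: image_image)
  qed
qed

section \<open>Structures turning disjoint unions into products\<close>

locale union_to_product =
  fixes \<Sigma> :: "'u signature" and F :: "'u set \<Rightarrow> ('u, 'u) struct" and pt :: 'u
  assumes univ: "set_universe TYPE('u)"
    and sig: "is_signature \<Sigma>"
    and F_struct: "\<And>X. small X \<Longrightarrow> F X \<in> Str \<Sigma>"
    and F_bij: "\<And>X Y. small X \<Longrightarrow> small Y \<Longrightarrow> X \<approx> Y \<Longrightarrow> isomorphic \<Sigma> (F X) (F Y)"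
    and F_union: "\<And>I X Z. small I \<Longrightarrow> (\<And>i. i \<in> I \<Longrightarrow> small (X i)) \<Longrightarrow> small Z \<Longrightarrow>
        is_disjoint_union Z I X \<Longrightarrow> isomorphic \<Sigma> (F Z) (prod_struct I (\<lambda>i. F (X i)))"
begin

abbreviation F1 :: "('u, 'u) struct" where "F1 \<equiv> F {pt}"

lemma small_singleton: "small {x :: 'u}"
  unfolding small_def using universe_infinite[OF univ] by (simp add: finite_lesspoll_infinite)

lemma F_is_struct: "small X \<Longrightarrow> is_struct \<Sigma> (F X)"
  using F_struct by (simp add: Str_def)

lemma F_carr: "small X \<Longrightarrow> s \<in> sorts \<Sigma> \<Longrightarrow> carr (F X) s \<prec> (UNIV :: 'u set)"
  using F_struct by (simp add: Str_def small_def)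

lemma isomorphic_singletons: "isomorphic \<Sigma> (F {x}) (F {y})"
  by (intro F_bij small_singleton singleton_eqpoll)

text \<open>A set is the disjoint union of its singletons.\<close>

lemma isomorphic_prod_singletons:
  assumes "small Z"
  shows "isomorphic \<Sigma> (F Z) (prod_struct Z (\<lambda>z. F {z}))"
proof (rule F_union[OF assms small_singleton assms])
  have "bij_betw (\<lambda>z. (z, z)) Z (SIGMA z:Z. {z})" by (auto simp: bij_betw_def inj_on_def)
  then show "is_disjoint_union Z Z (\<lambda>z. {z})" unfolding is_disjoint_union_def eqpoll_def by blast
qed

lemma isomorphic_power:
  assumes Z: "small Z" and ZH: "Z \<approx> H"
  shows "isomorphic \<Sigma> (prod_struct H (\<lambda>_. F1)) (F Z)"
proof -
  obtain b where b: "bij_betw b Z H" using ZH unfolding eqpoll_def by blast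
  have P: "is_struct \<Sigma> (prod_struct H (\<lambda>_. F1))" "is_struct \<Sigma> (prod_struct Z (\<lambda>z. F {z}))"
    by (rule is_struct_prod[OF F_is_struct[OF small_singleton]])+
  have "isomorphic \<Sigma> (prod_struct H (\<lambda>_. F1)) (prod_struct Z (\<lambda>z. F {z}))"
    by (rule isomorphic_prod_reindex[OF sig P(1) b isomorphic_singletons])
  moreover have "isomorphic \<Sigma> (prod_struct Z (\<lambda>z. F {z})) (F Z)"
    by (rule isomorphic_sym[OF sig F_is_struct[OF Z] P(2) isomorphic_prod_singletons[OF Z]])
  ultimately show ?thesis using isomorphic_trans[OF sig P(1)] by blast
qed

lemma separated_F:
  assumes "small X" shows "separated \<Sigma> (F X) F1"
proof -
  have "separated \<Sigma> (F {x}) F1" for x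
  proof -
    obtain h where "embedding \<Sigma> (F {x}) F1 h"
      using isomorphic_singletons unfolding isomorphic_def by blast
    then show ?thesis
      using separated_embedding[OF sig] separated_self[OF sig] F_is_struct[OF small_singleton] by blast
  qed
  then have "separated \<Sigma> (prod_struct X (\<lambda>x. F {x})) F1"
    using separated_prod[OF sig, where A = "\<lambda>x. F {x}"] F_is_struct[OF small_singleton] by blast
  moreover obtain h where "embedding \<Sigma> (F X) (prod_struct X (\<lambda>x. F {x})) h"
    using isomorphic_prod_singletons[OF assms] unfolding isomorphic_def by blast
  ultimately show ?thesis
    using separated_embedding[OF sig F_is_struct[OF assms]] by blast
qed

lemma Hom_lesspoll:
  assumes "\<And>s. s \<in> sorts \<Sigma> \<Longrightarrow> carr A s \<prec> (UNIV :: 'u set)"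
  shows "Hom \<Sigma> A F1 \<prec> (UNIV :: 'u set)"
proof -
  have "Hom \<Sigma> A F1 \<subseteq> (\<Pi>\<^sub>E s\<in>sorts \<Sigma>. carr A s \<rightarrow>\<^sub>E carr F1 s)" unfolding Hom_def by blast
  then have "Hom \<Sigma> A F1 \<lesssim> (\<Pi>\<^sub>E s\<in>sorts \<Sigma>. carr A s \<rightarrow>\<^sub>E carr F1 s)" by (rule subset_imp_lepoll)
  also have "\<dots> \<prec> (UNIV :: 'u set)"
    using sig assms F_carr[OF small_singleton]
    by (intro lesspoll_UNIV_PiE univ) (auto simp: is_signature_def small_def)
  finally show ?thesis .
qed

lemma gen_class_carr:
  assumes "A \<in> gen_class \<Sigma> F" "s \<in> sorts \<Sigma>"
  shows "carr A s \<prec> (UNIV :: 'u set)"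
proof -
  obtain X B h where X: "small X" "substructure \<Sigma> B (F X)" "embedding \<Sigma> A B h"
    using assms(1) unfolding gen_class_def isomorphic_def by blast
  then have "inj_on (h s) (carr A s)" "h s ` carr A s \<subseteq> carr B s"
    using assms(2) Hom_carr[of h \<Sigma> A B] unfolding embedding_def by auto
  then have "carr A s \<lesssim> carr B s" unfolding lepoll_def by blast
  also have "carr B s \<lesssim> carr (F X) s"
    using X(2) assms(2) by (intro subset_imp_lepoll) (auto simp: substructure_def)
  also have "\<dots> \<prec> (UNIV :: 'u set)" using F_carr[OF X(1) assms(2)] .
  finally show ?thesis .
qed

text \<open>
  On the one hand \<open>F X\<close> is a power of \<open>F1\<close>, hence separated, and so is all that embeds into it.
  On the other hand the power into which evaluation embeds a separated structure is \<open>F Z\<close> for a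
  set \<open>Z\<close> equipotent to the set of homomorphisms, which is small if the carriers are.
\<close>

lemma gen_class_iff_separated:
  "A \<in> gen_class \<Sigma> F \<longleftrightarrow>
     is_struct \<Sigma> A \<and> (\<forall>s\<in>sorts \<Sigma>. carr A s \<prec> (UNIV :: 'u set)) \<and> separated \<Sigma> A F1"
proof
  assume A: "A \<in> gen_class \<Sigma> F"
  then obtain X B h where X: "is_struct \<Sigma> A" "small X" "substructure \<Sigma> B (F X)" "embedding \<Sigma> A B h"
    unfolding gen_class_def isomorphic_def by blast
  have "is_struct \<Sigma> B" using X(3) by (simp add: substructure_def)
  then have "separated \<Sigma> B F1"
    using separated_embedding[OF sig _ embedding_substructure[OF sig X(3)] separated_F[OF X(2)]] by blast
  then have "separated \<Sigma> A F1" using separated_embedding[OF sig X(1) X(4)] by blast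
  then show "is_struct \<Sigma> A \<and> (\<forall>s\<in>sorts \<Sigma>. carr A s \<prec> (UNIV :: 'u set)) \<and> separated \<Sigma> A F1"
    using X(1) gen_class_carr[OF A] by blast
next
  assume A: "is_struct \<Sigma> A \<and> (\<forall>s\<in>sorts \<Sigma>. carr A s \<prec> (UNIV :: 'u set)) \<and> separated \<Sigma> A F1"
  let ?P = "prod_struct (Hom \<Sigma> A F1) (\<lambda>_. F1)"
  obtain Z :: "'u set" where Z: "small Z" "Z \<approx> Hom \<Sigma> A F1"
    using small_representative[OF Hom_lesspoll] A by blast
  obtain h where "embedding \<Sigma> A ?P h" using separated_imp_evaluation_embedding[OF sig] A by blast
  moreover obtain g where "embedding \<Sigma> ?P (F Z) g"
    using isomorphic_power[OF Z] unfolding isomorphic_def by blast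
  ultimately obtain k where "embedding \<Sigma> A (F Z) k" using embedding_compose[OF sig] A by blast
  then obtain B where "substructure \<Sigma> B (F Z)" "isomorphic \<Sigma> A B"
    using embedding_image[OF sig _ F_is_struct[OF Z(1)]] A by blast
  then show "A \<in> gen_class \<Sigma> F" unfolding gen_class_def using A Z(1) by blast
qed

lemma gen_class_Str: "A \<in> gen_class \<Sigma> F \<Longrightarrow> A \<in> Str \<Sigma>"
  by (auto simp: gen_class_iff_separated Str_def small_def)

lemma gen_class_substructure:
  assumes A: "A \<in> gen_class \<Sigma> F" and sub: "substructure \<Sigma> B A"
  shows "B \<in> gen_class \<Sigma> F"
proof -
  have B: "is_struct \<Sigma> B" "\<And>s. s \<in> sorts \<Sigma> \<Longrightarrow> carr B s \<subseteq> carr A s"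
    using sub unfolding substructure_def by simp_all
  have "carr B s \<prec> (UNIV :: 'u set)" if "s \<in> sorts \<Sigma>" for s
    using lesspoll_trans1[OF subset_imp_lepoll[OF B(2)[OF that]] gen_class_carr[OF A that]] .
  moreover have "separated \<Sigma> B F1"
    using separated_embedding[OF sig B(1) embedding_substructure[OF sig sub], of F1] A
    by (simp add: gen_class_iff_separated)
  ultimately show ?thesis using B(1) by (simp add: gen_class_iff_separated)
qed

lemma gen_class_prod:
  assumes "I \<prec> (UNIV :: 'u set)" and A: "\<And>i. i \<in> I \<Longrightarrow> A i \<in> gen_class \<Sigma> F"
  shows "prod_struct I A \<in> gen_class \<Sigma> F"
proof -
  have A': "is_struct \<Sigma> (A i)" "separated \<Sigma> (A i) F1" if "i \<in> I" for i
    using A[OF that] by (auto simp: gen_class_iff_separated)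
  have "carr (prod_struct I A) s \<prec> (UNIV :: 'u set)" if "s \<in> sorts \<Sigma>" for s
    unfolding prod_struct_def struct.select_convs
    using assms(1) gen_class_carr[OF A that] by (intro lesspoll_UNIV_PiE univ)
  then show ?thesis
    using is_struct_prod[OF A'(1)] separated_prod[OF sig A', of I] by (simp add: gen_class_iff_separated)
qed

lemma gen_class_horn_models: "gen_class \<Sigma> F \<subseteq> Mod \<Sigma> (horn_theory \<Sigma> F1)"
proof
  fix A :: "('u, 'u) struct"
  assume A: "A \<in> gen_class \<Sigma> F"
  then have "is_struct \<Sigma> A" "separated \<Sigma> A F1" by (simp_all add: gen_class_iff_separated)
  then have "holds A \<chi>" if "\<chi> \<in> horn_theory \<Sigma> F1" for \<chi>
    using horn_clause_separated[OF sig] that by (auto simp: horn_theory_def)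
  then show "A \<in> Mod \<Sigma> (horn_theory \<Sigma> F1)" using gen_class_Str[OF A] by (simp add: Mod_def)
qed

lemma ingredients_lesspoll:
  assumes "A \<in> Str \<Sigma>"
  shows "ingredients \<Sigma> A \<prec> (UNIV :: 'u set)"
  unfolding ingredients_def using sig assms
  by (intro lesspoll_UNIV_Plus lesspoll_UNIV_Sigma univ) (auto simp: is_signature_def Str_def small_def)

text \<open>
  The class contains an ultrapower of \<open>F1\<close> that receives enough homomorphisms from a model \<open>A\<close> of
  the Horn theory. The indices are the finite sets \<open>D\<close> of ingredients of \<open>A\<close>, and almost all of
  them contain any given ingredients. Hence local homomorphisms on all the \<open>D\<close>, extended
  arbitrarily to the remaining elements, induce a homomorphism, and it distinguishes what almost all
  of the local ones distinguish.

  The ultrapower is formed from an expansion \<open>M\<close> of \<open>F1\<close> to a model of the theory defining the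
  class; by the theorem of Los it is again the expansion of a member of the class.
\<close>

lemma horn_model_separated:
  assumes pe: "pseudo_elementary \<Sigma> (gen_class \<Sigma> F)" and A: "A \<in> Mod \<Sigma> (horn_theory \<Sigma> F1)"
  shows "separated \<Sigma> A F1"
proof -
  obtain \<Sigma>' T' where sig': "is_signature \<Sigma>'" and sub: "subsignature \<Sigma> \<Sigma>'" and T': "T' \<subseteq> sentences \<Sigma>'"
    and K: "gen_class \<Sigma> F = {A \<in> Str \<Sigma>. \<exists>M\<in>Mod \<Sigma>' T'. agree_on \<Sigma> A M}"
    using pe unfolding pseudo_elementary_def by blast
  have AS: "A \<in> Str \<Sigma>" and A_struct: "is_struct \<Sigma> A" and horn: "\<forall>\<chi>\<in>horn_theory \<Sigma> F1. holds A \<chi>"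
    using A by (auto simp: Mod_def Str_def)
  have "F1 \<in> gen_class \<Sigma> F"
    using F_is_struct F_carr separated_self[OF sig, of F1] small_singleton by (simp add: gen_class_iff_separated)
  then obtain M where M: "M \<in> Mod \<Sigma>' T'" and agree: "agree_on \<Sigma> F1 M" unfolding K by blast
  have M_struct: "is_struct \<Sigma>' M" and M_carr: "\<And>s. s \<in> sorts \<Sigma>' \<Longrightarrow> carr M s \<prec> (UNIV :: 'u set)"
    using M by (auto simp: Mod_def Str_def small_def)
  have carr_M: "carr M s = carr F1 s" if "s \<in> sorts \<Sigma>" for s using agree that by (simp add: agree_on_def)
  define G where "G = ingredients \<Sigma> A"
  define I where "I = {D. finite D \<and> D \<subseteq> G}"
  have "I \<lesssim> Pow G" unfolding I_def by (intro subset_imp_lepoll) blast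
  also have "Pow G \<prec> (UNIV :: 'u set)"
    unfolding G_def by (intro lesspoll_UNIV_Pow univ ingredients_lesspoll AS)
  finally have I_small: "I \<prec> (UNIV :: 'u set)" .
  obtain U where ultra: "ultrafilter U" and U: "U \<le> finite_subsets_at_top G"
    using ultrafilter_exists[OF finite_subsets_at_top_neq_bot] by blast
  have above: "eventually (\<lambda>D. D \<in> I \<and> D0 \<subseteq> D) U" if "D0 \<in> I" for D0
  proof (rule filter_leD[OF U])
    show "eventually (\<lambda>D. D \<in> I \<and> D0 \<subseteq> D) (finite_subsets_at_top G)"
      unfolding eventually_finite_subsets_at_top I_def using that by (intro exI[of _ D0]) (auto simp: I_def)
  qed
  have in_I: "eventually (\<lambda>D. D \<in> I) U"
    using above[of "{}"] by (auto simp: I_def elim: eventually_mono)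
  obtain c :: "'u \<Rightarrow> _ \<Rightarrow> 'u" where
    c: "\<And>s x y. s \<in> sorts \<Sigma>' \<Longrightarrow> x \<in> I \<rightarrow> carr M s \<Longrightarrow> y \<in> I \<rightarrow> carr M s \<Longrightarrow>
      c s x = c s y \<longleftrightarrow> eventually (\<lambda>D. x D = y D) U"
    and c_small: "\<And>s. s \<in> sorts \<Sigma>' \<Longrightarrow> small (c s ` (I \<rightarrow> carr M s))"
    using ultrapower_codes[OF univ I_small M_carr in_I] by blast
  interpret pw: ultrapower \<Sigma>' M I U c
    using sig' M_struct ultra in_I c by unfold_locales
  have sub': "sorts \<Sigma> \<subseteq> sorts \<Sigma>'" "funs \<Sigma> \<subseteq> funs \<Sigma>'"
    "\<And>f. f \<in> funs \<Sigma> \<Longrightarrow> fun_dom \<Sigma>' f = fun_dom \<Sigma> f \<and> fun_cod \<Sigma>' f = fun_cod \<Sigma> f"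
    using sub unfolding subsignature_def by auto
  have power_small: "small (carr pw.power s)" if "s \<in> sorts \<Sigma>'" for s
    using c_small[OF that] by (simp add: pw.power_def)
  moreover have "holds pw.power \<phi>" if "\<phi> \<in> T'" for \<phi>
    using that T' M by (intro pw.holds_power) (auto simp: Mod_def)
  ultimately have "pw.power \<in> Mod \<Sigma>' T'" using pw.is_struct_power by (simp add: Mod_def Str_def)
  moreover have "is_struct \<Sigma> pw.power"
    using pw.is_struct_power sub'(2,3) unfolding is_struct_def by force
  then have "pw.power \<in> Str \<Sigma>" using power_small sub'(1) by (auto simp: Str_def)
  moreover have "agree_on \<Sigma> pw.power pw.power" by (simp add: agree_on_def)
  ultimately have "pw.power \<in> gen_class \<Sigma> F" unfolding K by blast
  then have sep: "separated \<Sigma> pw.power F1" by (simp add: gen_class_iff_separated)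

  \<comment> \<open>Outside its domain a local homomorphism takes a fixed value, so as to be a total family.\<close>
  define X where "X g s a D = (if Inl (s, a) \<in> D then g D s a else SOME b. b \<in> carr M s)"
    for g :: "_ \<Rightarrow> 'u \<Rightarrow> 'u \<Rightarrow> 'u" and s a and D :: "(('u \<times> 'u) + 'u + 'u) set"
  define h where "h g = hom_family \<Sigma> A (\<lambda>s a. c s (X g s a))" for g
  define loc where "loc = {g. \<forall>D\<in>I. local_hom \<Sigma> A F1 D (g D)}"
  have X_carr: "X g s a \<in> I \<rightarrow> carr M s" if g: "g \<in> loc" and s: "s \<in> sorts \<Sigma>" and a: "a \<in> carr A s" for g s a
  proof -
    have g_carr: "g D s a \<in> carr M s" if "D \<in> I" "Inl (s, a) \<in> D" for D
      using g that carr_M[OF s] by (auto simp: loc_def local_hom_def)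
    have "{Inl (s, a)} \<in> I" using s a by (auto simp: I_def G_def ingredients_def)
    then have "carr M s \<noteq> {}" using g_carr by blast
    then show ?thesis using g_carr by (auto simp: X_def some_in_eq)
  qed
  have elems: "finite D0 \<Longrightarrow> D0 \<subseteq> G \<Longrightarrow> D0 \<in> I" for D0 by (simp add: I_def)
  have zip_G: "Inl ` set (zip ss ys) \<subseteq> G" if "set ss \<subseteq> sorts \<Sigma>" "ys \<in> tuples A ss" for ss ys
  proof -
    have "list_all2 (\<lambda>y s. y \<in> carr A s) ys ss" using that(2) by (simp add: tuples_def)
    then show ?thesis using that(1)
      by (induction rule: list_all2_induct) (auto simp: G_def ingredients_def)
  qed
  have X_map2: "map2 (\<lambda>s a. X g s a D) ss ys = map2 (g D) ss ys" if "Inl ` set (zip ss ys) \<subseteq> D" for g D ss ys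
    using that by (auto simp: X_def)
  have g_tuples: "map2 (g D) ss ys \<in> tuples F1 ss"
    if "g \<in> loc" "D \<in> I" "Inl ` set (zip ss ys) \<subseteq> D" "ys \<in> tuples A ss" for g D ss ys
  proof -
    have loc: "local_hom \<Sigma> A F1 D (g D)" using that(1,2) by (simp add: loc_def)
    have "list_all2 (\<lambda>y s. y \<in> carr A s) ys ss" using that(4) by (simp add: tuples_def)
    then have "list_all2 (\<lambda>y s. y \<in> carr F1 s) (map2 (g D) ss ys) ss" using that(3)
      by (induction rule: list_all2_induct) (use loc in \<open>auto simp: local_hom_def\<close>)
    then show ?thesis by (simp add: tuples_def)
  qed
  have X_fun: "eventually (\<lambda>D. X g (fun_cod \<Sigma> f) (fint A f ys) D
      = fint M f (map2 (\<lambda>s a. X g s a D) (fun_dom \<Sigma> f) ys)) U"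
    if g: "g \<in> loc" and f: "f \<in> funs \<Sigma>" and ys: "ys \<in> tuples A (fun_dom \<Sigma> f)" for g f ys
  proof -
    let ?D0 = "insert (Inr (Inl f)) (insert (Inl (fun_cod \<Sigma> f, fint A f ys)) (Inl ` set (zip (fun_dom \<Sigma> f) ys)))"
    have "fint A f ys \<in> carr A (fun_cod \<Sigma> f)" using A_struct f ys by (simp add: is_struct_def)
    then have "?D0 \<subseteq> G"
      using f signature_sorts(2)[OF sig f] zip_G[OF signature_sorts(1)[OF sig f] ys]
      by (auto simp: G_def ingredients_def)
    then have "?D0 \<in> I" by (intro elems) auto
    then show ?thesis
    proof (rule eventually_mono[OF above])
      fix D assume "D \<in> I \<and> ?D0 \<subseteq> D"
      then have D: "D \<in> I" "Inr (Inl f) \<in> D" "Inl (fun_cod \<Sigma> f, fint A f ys) \<in> D"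
        "Inl ` set (zip (fun_dom \<Sigma> f) ys) \<subseteq> D" by auto
      have "g D (fun_cod \<Sigma> f) (fint A f ys) = fint F1 f (map2 (g D) (fun_dom \<Sigma> f) ys)"
        using g D ys by (auto simp: loc_def local_hom_def)
      also have "\<dots> = fint M f (map2 (g D) (fun_dom \<Sigma> f) ys)"
        using agree f g_tuples[OF g D(1,4) ys] by (simp add: agree_on_def)
      finally show "X g (fun_cod \<Sigma> f) (fint A f ys) D = fint M f (map2 (\<lambda>s a. X g s a D) (fun_dom \<Sigma> f) ys)"
        unfolding X_map2[OF D(4)] using D(3) by (simp add: X_def)
    qed
  qed
  have X_rel: "eventually (\<lambda>D. D \<in> I \<and> Inr (Inr r) \<in> D \<and> Inl ` set (zip (rel_dom \<Sigma> r) ys) \<subseteq> D \<and>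
      (rint M r (map2 (\<lambda>s a. X g s a D) (rel_dom \<Sigma> r) ys) \<longleftrightarrow> rint F1 r (map2 (g D) (rel_dom \<Sigma> r) ys))) U"
    if g: "g \<in> loc" and r: "r \<in> rels \<Sigma>" and ys: "ys \<in> tuples A (rel_dom \<Sigma> r)" for g r ys
  proof -
    let ?D0 = "insert (Inr (Inr r)) (Inl ` set (zip (rel_dom \<Sigma> r) ys))"
    have "?D0 \<subseteq> G"
      using r zip_G[OF signature_sorts(3)[OF sig r] ys] by (auto simp: G_def ingredients_def)
    then have "?D0 \<in> I" by (intro elems) auto
    then show ?thesis
    proof (rule eventually_mono[OF above])
      fix D assume "D \<in> I \<and> ?D0 \<subseteq> D"
      then have D: "D \<in> I" "Inr (Inr r) \<in> D" "Inl ` set (zip (rel_dom \<Sigma> r) ys) \<subseteq> D" by auto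
      then show "D \<in> I \<and> Inr (Inr r) \<in> D \<and> Inl ` set (zip (rel_dom \<Sigma> r) ys) \<subseteq> D \<and>
        (rint M r (map2 (\<lambda>s a. X g s a D) (rel_dom \<Sigma> r) ys) \<longleftrightarrow> rint F1 r (map2 (g D) (rel_dom \<Sigma> r) ys))"
        unfolding X_map2[OF D(3)] using agree r g_tuples[OF g D(1,3) ys] by (simp add: agree_on_def)
    qed
  qed
  have X_rel_pos: "eventually (\<lambda>D. rint M r (map2 (\<lambda>s a. X g s a D) (rel_dom \<Sigma> r) ys)) U"
    if g: "g \<in> loc" and r: "r \<in> rels \<Sigma>" and ys: "ys \<in> tuples A (rel_dom \<Sigma> r)" "rint A r ys" for g r ys
    using X_rel[OF g r ys(1)]
  proof (rule eventually_mono)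
    fix D assume D: "D \<in> I \<and> Inr (Inr r) \<in> D \<and> Inl ` set (zip (rel_dom \<Sigma> r) ys) \<subseteq> D \<and>
      (rint M r (map2 (\<lambda>s a. X g s a D) (rel_dom \<Sigma> r) ys) \<longleftrightarrow> rint F1 r (map2 (g D) (rel_dom \<Sigma> r) ys))"
    then have "rint F1 r (map2 (g D) (rel_dom \<Sigma> r) ys)"
      using g ys by (simp add: loc_def local_hom_def)
    then show "rint M r (map2 (\<lambda>s a. X g s a D) (rel_dom \<Sigma> r) ys)" using D by blast
  qed
  have h_Hom: "h g \<in> Hom \<Sigma> A pw.power" if g: "g \<in> loc" for g
    unfolding h_def by (rule pw.induced_hom[OF sig sub X_carr[OF g] A_struct X_fun[OF g] X_rel_pos[OF g]])
  have h_eq: "c s (X g s a) = c s (X g s b) \<longleftrightarrow> eventually (\<lambda>D. X g s a D = X g s b D) U"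
    if g: "g \<in> loc" and sab: "s \<in> sorts \<Sigma>" "a \<in> carr A s" "b \<in> carr A s" for g s a b
    using sub'(1) X_carr[OF g] sab by (intro c) auto
  have h_rint: "rint pw.power r (map2 (\<lambda>s a. c s (X g s a)) (rel_dom \<Sigma> r) ys) \<longleftrightarrow>
      eventually (\<lambda>D. rint M r (map2 (\<lambda>s a. X g s a D) (rel_dom \<Sigma> r) ys)) U"
    if g: "g \<in> loc" and r: "r \<in> rels \<Sigma>" and ys: "ys \<in> tuples A (rel_dom \<Sigma> r)" for g r ys
    by (rule pw.induced_rint[OF sig sub X_carr[OF g] r ys])
  show ?thesis
  proof (rule separated_family[OF sig A_struct, where I = loc and g = h and B = "\<lambda>_. pw.power"])
    show "h g \<in> Hom \<Sigma> A pw.power" if "g \<in> loc" for g using h_Hom[OF that] .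
  next
    fix s a b assume s: "s \<in> sorts \<Sigma>" and ab: "a \<in> carr A s" "b \<in> carr A s" "a \<noteq> b"
    let ?D0 = "{Inl (s, a), Inl (s, b)}"
    have D0: "?D0 \<in> I" using s ab by (intro elems) (auto simp: G_def ingredients_def)
    \<comment> \<open>An index that does not contain the two elements is served by a larger one that does.\<close>
    have "\<exists>g. local_hom \<Sigma> A F1 (D \<union> ?D0) g \<and> g s a \<noteq> g s b" if "D \<in> I" for D
      using that D0 ab(3) by (intro local_hom_distinguishes[OF horn]) (auto simp: I_def G_def)
    then obtain g where g: "\<And>D. D \<in> I \<Longrightarrow> local_hom \<Sigma> A F1 (D \<union> ?D0) (g D) \<and> g D s a \<noteq> g D s b"
      by metis
    then have gl: "g \<in> loc" unfolding loc_def using local_hom_mono[OF _ Un_upper1] by blast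
    have "eventually (\<lambda>D. X g s a D \<noteq> X g s b D) U"
      using above[OF D0] by (rule eventually_mono) (use g in \<open>auto simp: X_def\<close>)
    then have "c s (X g s a) \<noteq> c s (X g s b)"
      using h_eq[OF gl s ab(1,2)] ultrafilter_not[OF ultra] by blast
    then show "\<exists>g\<in>loc. h g s a \<noteq> h g s b" using gl s ab by (auto simp: h_def)
  next
    fix r ys assume r: "r \<in> rels \<Sigma>" and ys: "ys \<in> tuples A (rel_dom \<Sigma> r)" and neg: "\<not> rint A r ys"
    let ?D0 = "Inl ` set (zip (rel_dom \<Sigma> r) ys)"
    have D0: "?D0 \<in> I" using zip_G[OF signature_sorts(3)[OF sig r] ys] by (intro elems) auto
    have "\<exists>g. local_hom \<Sigma> A F1 (D \<union> ?D0) g \<and> \<not> rint F1 r (map2 g (rel_dom \<Sigma> r) ys)" if "D \<in> I" for D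
      using that D0 neg r ys by (intro local_hom_refutes[OF sig horn]) (auto simp: I_def G_def)
    then obtain g where g: "\<And>D. D \<in> I \<Longrightarrow> local_hom \<Sigma> A F1 (D \<union> ?D0) (g D) \<and>
        \<not> rint F1 r (map2 (g D) (rel_dom \<Sigma> r) ys)"
      by metis
    then have gl: "g \<in> loc" unfolding loc_def using local_hom_mono[OF _ Un_upper1] by blast
    have "eventually (\<lambda>D. \<not> rint M r (map2 (\<lambda>s a. X g s a D) (rel_dom \<Sigma> r) ys)) U"
      using X_rel[OF gl r ys] by (rule eventually_mono) (use g in blast)
    then have "\<not> rint pw.power r (map2 (\<lambda>s a. c s (X g s a)) (rel_dom \<Sigma> r) ys)"
      using h_rint[OF gl r ys] ultrafilter_not[OF ultra] by blast
    then show "\<exists>g\<in>loc. \<not> rint pw.power r (map2 (h g) (rel_dom \<Sigma> r) ys)"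
      using gl unfolding h_def map2_hom_family[OF signature_sorts(3)[OF sig r] ys] by blast
  qed (rule sep)
qed

lemma gen_class_eq_horn_models:
  assumes "pseudo_elementary \<Sigma> (gen_class \<Sigma> F)"
  shows "gen_class \<Sigma> F = Mod \<Sigma> (horn_theory \<Sigma> F1)"
proof (rule equalityI[OF gen_class_horn_models subsetI])
  fix A assume A: "A \<in> Mod \<Sigma> (horn_theory \<Sigma> F1)"
  then show "A \<in> gen_class \<Sigma> F"
    using horn_model_separated[OF assms A] by (simp add: gen_class_iff_separated Mod_def Str_def small_def)
qed

end

theorem proposition3p6:
  fixes \<Sigma> :: "'u signature"
    and F :: "'u set \<Rightarrow> ('u, 'u) struct"
    and pt :: 'u
  assumes univ: "set_universe TYPE('u)"
    and sig: "is_signature \<Sigma>"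
    and F_struct: "\<And>X. small X \<Longrightarrow> F X \<in> Str \<Sigma>"
    and F_bij: "\<And>X Y. small X \<Longrightarrow> small Y \<Longrightarrow> X \<approx> Y \<Longrightarrow> isomorphic \<Sigma> (F X) (F Y)"
    and F_union: "\<And>I X Z. small I \<Longrightarrow> (\<And>i. i \<in> I \<Longrightarrow> small (X i)) \<Longrightarrow> small Z \<Longrightarrow>
        is_disjoint_union Z I X \<Longrightarrow> isomorphic \<Sigma> (F Z) (prod_struct I (\<lambda>i. F (X i)))"
  shows
    "(\<forall>A B :: ('u, 'u) struct.
        A \<in> gen_class \<Sigma> F \<and> substructure \<Sigma> B A \<longrightarrow> B \<in> gen_class \<Sigma> F) \<and>
     (\<forall>(I :: 'u set) (A :: 'u \<Rightarrow> ('u, 'u) struct).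
        small I \<and> (\<forall>i\<in>I. A i \<in> gen_class \<Sigma> F) \<longrightarrow> prod_struct I A \<in> gen_class \<Sigma> F) \<and>
     (\<forall>A :: ('u, 'u) struct. A \<in> gen_class \<Sigma> F \<longrightarrow>
        (let H = Hom \<Sigma> A (F {pt}); P = prod_struct H (\<lambda>_. F {pt}) in
           embedding \<Sigma> A P (\<lambda>s\<in>sorts \<Sigma>. \<lambda>a\<in>carr A s. \<lambda>\<phi>\<in>H. \<phi> s a) \<and>
           (\<exists>Z :: 'u set. small Z \<and> Z \<approx> H) \<and>
           (\<forall>Z :: 'u set. small Z \<and> Z \<approx> H \<longrightarrow> isomorphic \<Sigma> P (F Z)))) \<and>
     (pseudo_elementary \<Sigma> (gen_class \<Sigma> F) \<longrightarrow>
        elementary \<Sigma> (gen_class \<Sigma> F) \<and>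
        gen_class \<Sigma> F = Mod \<Sigma> (horn_theory \<Sigma> (F {pt})))"
proof -
  interpret union_to_product \<Sigma> F pt
    by unfold_locales (fact univ sig F_struct F_bij F_union)+
  have eval: "embedding \<Sigma> A (prod_struct (Hom \<Sigma> A F1) (\<lambda>_. F1))
      (\<lambda>s\<in>sorts \<Sigma>. \<lambda>a\<in>carr A s. \<lambda>\<phi>\<in>Hom \<Sigma> A F1. \<phi> s a)"
    if "A \<in> gen_class \<Sigma> F" for A :: "('u, 'u) struct"
    using that separated_imp_evaluation_embedding[OF sig, of A F1] by (simp add: gen_class_iff_separated)
  have prod: "prod_struct I A \<in> gen_class \<Sigma> F" if "small I" "\<forall>i\<in>I. A i \<in> gen_class \<Sigma> F"
    for I :: "'u set" and A :: "'u \<Rightarrow> ('u, 'u) struct"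
    using gen_class_prod[of I A] that by (simp add: small_def)
  have rep: "\<exists>Z :: 'u set. small Z \<and> Z \<approx> Hom \<Sigma> A F1"
    if "A \<in> gen_class \<Sigma> F" for A :: "('u, 'u) struct"
    using small_representative[OF Hom_lesspoll[OF gen_class_carr[OF that]]] by blast
  have "horn_theory \<Sigma> F1 \<subseteq> sentences \<Sigma>"
    using horn_clauses_sentences by (auto simp: horn_theory_def)
  then have "elementary \<Sigma> (gen_class \<Sigma> F) \<and> gen_class \<Sigma> F = Mod \<Sigma> (horn_theory \<Sigma> F1)"
    if "pseudo_elementary \<Sigma> (gen_class \<Sigma> F)"
    using gen_class_eq_horn_models[OF that] unfolding elementary_def by blast
  then show ?thesis
    unfolding Let_def using gen_class_substructure prod eval rep isomorphic_power by blast
qed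

end
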